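(* Let $\Theta$ be an open subset of $\mathbb{R}$, let $\{\exp(\phi(\cdot;m)):m\in\Theta\}$ be a family of probability densities with respect to a fixed measure, where $\phi$ is twice differentiable with respect to the parameter $m$ with $i$-th derivative $\phi_i$, and suppose that for each $m$, when $X$ has density $\exp(\phi(\cdot;m))$, $\phi_1(X,m)$ has mean $0$ and finite variance $\iota(m)$ and $\phi_2(X,m)$ has mean $-\iota(m)$. Let $\Theta_0$ be a fixed compact subset of $\Theta$ and let $\delta>0$ be fixed. Assume: (a) there is a constant $\alpha$ such that for all $m,m^*\in\Theta_0$, $$|\mathrm{E}_m(\phi(X;m^* )-\phi(X;m))|\le\alpha(m^*-m)^2 \quad\text{and}\quad \mathrm{Var}_m(\phi(X;m^* )-\phi(X;m))\le\alpha(m^*-m)^2;$$ (b) $\sup\{\mathrm{E}_m(|\phi_2(X,m)+\iota(m)|\,1(|\phi_2(X,m)+\iota(m)|\ge t)) : m\in\Theta_0\}\to 0$ as $t\to\infty$; (c) with $W(X,\epsilon,m)=\sup\{|\phi_2(X,m')-\phi_2(X,m)| : |m'-m|\le\epsilon,\ m'\in\Theta_0\}$, $$\lim_{\epsilon\to 0}\sup\{\mathrm{E}_m(W(X,\epsilon,m)) : m\in\Theta_0\}=0;$$ (d) the map $$(m,m')\mapsto\begin{cases}\mathcal{L}\big((\phi(X,m)-\phi(X,m'))/(m-m')\,\big|\,m'\big) & m\ne m'\\ \mathcal{L}(\phi_1(X,m')\,|\,m') & m=m'\end{cases}$$ is continuous from $\Theta_0\times\Theta_0$ to $\Delta$. For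 each $n$ and $m=(m_1,\ldots,m_n)\in\Theta^n$, let $X=(X_1,\ldots,X_n)^{\mathrm T}$ have, under $m$, independent entries with $X_i$ having density $\exp(\phi(\cdot;m_i))$, and let $\mathcal{T}=\mathcal{T}_n$ be the family of all test functions $T(X)$ invariant under permutations of the entries of $X$. Then, as $n\to\infty$, $$\sup\{|\mathrm{E}_m(T)-\mathrm{E}_{\overline m}(T)| : T\in\mathcal{T},\ \|m-\overline m\|\le\delta,\ m_i\in\Theta_0\text{ for }i=1,\ldots,n\}\to 0 .$$
   Context: In assumptions (a)–(d), $m,m',m^*$ are scalars, $X$ is a single observation, $\mathrm{E}_m,\mathrm{Var}_m$ are taken when $X$ has density $\exp(\phi(\cdot;m))$, and $\mathcal{L}(Y\,|\,m)$ denotes the law of $Y$ when $X$ has this density. $\phi(x,m)$ and $\phi(x;m)$ mean the same thing, and likewise for $\phi_1,\phi_2$. $\Delta$ is the set of probability distributions on $\mathbb{R}$ with finite variance, with the topology in which $F_n\to\Phi$ iff $\mathrm{E}_{F_n}(\gamma(X))\to\mathrm{E}_\Phi(\gamma(X))$ for every continuous $\gamma$ such that $\gamma(x)/(1+x^2)$ is bounded; equivalently, convergence in distribution together with convergence of second moments (metrized by the Wasserstein metric of order 2). In the conclusion, $m\in\mathbb{R}^n$, $\overline m=\sum_{i=1}^n m_i/n$, and $\overline m$ also denotes the $n$-vector with all entries $\overline m$, so that $\|m-\overline m\|^2=\sum_i(m_i-\overline m)^2$ and under $\overline m$ the $X_i$ are i.i.d. with density $\exp(\phi(\cdot;\overline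 m))$. A test function is a measurable function of the data with values in $[0,1]$.
   Formalization: The supremum is restricted to vectors m whose mean also lies in Θ₀ (automatic when Θ₀ is an interval); without this the claim fails for compact Θ₀ with gaps, since (a)–(d) say nothing about the law at the mean. *)

theory Defs
  imports "HOL-Probability.Probability" "HOL-Combinatorics.Permutations"
begin

definition obs_law :: "'a measure \<Rightarrow> ('a \<Rightarrow> real \<Rightarrow> real) \<Rightarrow> real \<Rightarrow> 'a measure" where
  "obs_law \<mu> \<phi> m = density \<mu> (\<lambda>x. ennreal (exp (\<phi> x m)))"

definition data_law ::
    "'a measure \<Rightarrow> ('a \<Rightarrow> real \<Rightarrow> real) \<Rightarrow> nat \<Rightarrow> (nat \<Rightarrow> real) \<Rightarrow> (nat \<Rightarrow> 'a) measure" where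
  "data_law \<mu> \<phi> n m = PiM {..<n} (\<lambda>i. obs_law \<mu> \<phi> (m i))"

definition vec_mean :: "nat \<Rightarrow> (nat \<Rightarrow> real) \<Rightarrow> real" where
  "vec_mean n m = (\<Sum>i<n. m i) / real n"

definition invariant_tests :: "'a measure \<Rightarrow> nat \<Rightarrow> ((nat \<Rightarrow> 'a) \<Rightarrow> real) set" where
  "invariant_tests \<mu> n =
     {T \<in> borel_measurable (PiM {..<n} (\<lambda>_. \<mu>)).
        \<forall>x \<in> space (PiM {..<n} (\<lambda>_. \<mu>)).
          T x \<in> {0..1} \<and> (\<forall>\<pi>. \<pi> permutes {..<n} \<longrightarrow> T (x \<circ> \<pi>) = T x)}"

(* The modulus W is [0,\<infinity>]-valued, as the supremum may be infinite. It is a supremum over an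
   uncountable set and need not be measurable; its nn_integral is then the lower integral, which
   agrees with the integral whenever W is measurable for the completion of the law. *)
definition modulus ::
    "('a \<Rightarrow> real \<Rightarrow> real) \<Rightarrow> real set \<Rightarrow> real \<Rightarrow> real \<Rightarrow> 'a \<Rightarrow> ennreal" where
  "modulus \<psi> \<Theta>\<^sub>0 \<epsilon> m x =
     (SUP m' \<in> {m' \<in> \<Theta>\<^sub>0. \<bar>m' - m\<bar> \<le> \<epsilon>}. ennreal \<bar>\<psi> x m' - \<psi> x m\<bar>)"

definition quotient_law ::
    "'a measure \<Rightarrow> ('a \<Rightarrow> real \<Rightarrow> real) \<Rightarrow> ('a \<Rightarrow> real \<Rightarrow> real) \<Rightarrow> real \<Rightarrow> real \<Rightarrow> real measure" where
  "quotient_law \<mu> \<phi> \<phi>\<^sub>1 m m' =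
     distr (obs_law \<mu> \<phi> m') borel
       (if m = m' then (\<lambda>x. \<phi>\<^sub>1 x m') else (\<lambda>x. (\<phi> x m - \<phi> x m') / (m - m')))"

definition finite_variance_laws :: "real measure set" where
  "finite_variance_laws = {F. prob_space F \<and> sets F = sets borel \<and> integrable F (\<lambda>x. x\<^sup>2)}"

definition quadratic_growth :: "(real \<Rightarrow> real) set" where
  "quadratic_growth =
     {\<gamma>. continuous_on UNIV \<gamma> \<and> bounded (range (\<lambda>x. \<gamma> x / (1 + x\<^sup>2)))}"

(* The initial topology for the maps sending F to the integral of \<gamma> with respect to F. It is
   the topology of weak convergence of the finite measures (1 + x^2) F(dx), hence metrizable, by
   the Wasserstein metric of order 2. *)
definition finite_variance_topology :: "real measure topology" where
  "finite_variance_topology =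
     topology_generated_by
       {{F \<in> finite_variance_laws. (\<integral>x. \<gamma> x \<partial>F) \<in> U} | \<gamma> U. \<gamma> \<in> quadratic_growth \<and> open U}"

lemma topspace_finite_variance_topology:
  "topspace finite_variance_topology = finite_variance_laws"
proof -
  have "(\<lambda>_. 0) \<in> quadratic_growth"
    by (simp add: quadratic_growth_def)
  then have "finite_variance_laws \<in>
      {{F \<in> finite_variance_laws. (\<integral>x. \<gamma> x \<partial>F) \<in> U} | \<gamma> U. \<gamma> \<in> quadratic_growth \<and> open U}"
    using open_UNIV by (intro CollectI exI[of _ "\<lambda>_. 0"] exI[of _ UNIV]) simp
  then show ?thesis
    unfolding finite_variance_topology_def topology_generated_by_topspace
    by (intro equalityI Union_upper Union_least) blast+
qed

lemma limitin_finite_variance_topology: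
  "limitin finite_variance_topology F \<Phi> sequentially \<longleftrightarrow>
     \<Phi> \<in> finite_variance_laws \<and> (\<forall>\<^sub>F n in sequentially. F n \<in> finite_variance_laws) \<and>
     (\<forall>\<gamma> \<in> quadratic_growth. (\<lambda>n. \<integral>x. \<gamma> x \<partial>F n) \<longlonglongrightarrow> (\<integral>x. \<gamma> x \<partial>\<Phi>))"
  (is "?L \<longleftrightarrow> ?R")
proof
  assume L: ?L
  have Phi: "\<Phi> \<in> finite_variance_laws"
    using L limitin_topspace topspace_finite_variance_topology by metis
  have basic: "\<forall>\<^sub>F n in sequentially. F n \<in> finite_variance_laws \<and> (\<integral>x. \<gamma> x \<partial>F n) \<in> U"
    if "\<gamma> \<in> quadratic_growth" "open U" "(\<integral>x. \<gamma> x \<partial>\<Phi>) \<in> U" for \<gamma> U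
  proof -
    have "openin finite_variance_topology {G \<in> finite_variance_laws. (\<integral>x. \<gamma> x \<partial>G) \<in> U}"
      unfolding finite_variance_topology_def
      by (rule topology_generated_by_Basis) (use that in blast)
    then have "\<forall>\<^sub>F n in sequentially. F n \<in> {G \<in> finite_variance_laws. (\<integral>x. \<gamma> x \<partial>G) \<in> U}"
      using L Phi that unfolding limitin_def by blast
    then show ?thesis by simp
  qed
  have "(\<lambda>_. 0) \<in> quadratic_growth"
    by (simp add: quadratic_growth_def)
  from basic[OF this open_UNIV] have ev: "\<forall>\<^sub>F n in sequentially. F n \<in> finite_variance_laws"
    by simp
  have "(\<lambda>n. \<integral>x. \<gamma> x \<partial>F n) \<longlonglongrightarrow> (\<integral>x. \<gamma> x \<partial>\<Phi>)" if "\<gamma> \<in> quadratic_growth" for \<gamma>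
    by (rule topological_tendstoI, rule eventually_mono, rule basic[OF that])
      (assumption | erule conjunct2)+
  with Phi ev show ?R by blast
next
  assume R: ?R
  have "\<forall>\<^sub>F n in sequentially. F n \<in> V"
    if "generate_topology_on
          {{F \<in> finite_variance_laws. (\<integral>x. \<gamma> x \<partial>F) \<in> U} | \<gamma> U. \<gamma> \<in> quadratic_growth \<and> open U} V"
      and "\<Phi> \<in> V" for V
    using that
  proof (induction rule: generate_topology_on.induct)
    case Empty
    then show ?case by simp
  next
    case (Int a b)
    then show ?case by (auto intro: eventually_conj)
  next
    case (UN K)
    then obtain k where "k \<in> K" "\<Phi> \<in> k" by blast
    with UN.IH[of k] show ?case by (auto elim: eventually_mono)
  next
    case (Basis s)
    then obtain \<gamma> U where s: "s = {G \<in> finite_variance_laws. (\<integral>x. \<gamma> x \<partial>G) \<in> U}"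
      and g: "\<gamma> \<in> quadratic_growth" and U: "open U" by blast
    have "\<forall>\<^sub>F n in sequentially. (\<integral>x. \<gamma> x \<partial>F n) \<in> U"
      using R g U Basis.prems s by (auto intro: topological_tendstoD)
    with R show ?case unfolding s by (auto intro: eventually_conj)
  qed
  then show ?L
    using R unfolding limitin_def topspace_finite_variance_topology
    by (auto simp: finite_variance_topology_def openin_topology_generated_by_iff)
qed

(* Suprema are taken in [0,\<infinity>], so that a supremum over the empty set is 0.
   Membership of the mean in \<Theta>\<^sub>0 is automatic if \<Theta>\<^sub>0 is an interval. If \<Theta>\<^sub>0 has gaps, then without
   it the hypotheses say nothing about the law at the mean, and the supremum need not tend to 0. *)
definition max_discrepancy ::
    "'a measure \<Rightarrow> ('a \<Rightarrow> real \<Rightarrow> real) \<Rightarrow> real set \<Rightarrow> real \<Rightarrow> nat \<Rightarrow> ennreal" where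
  "max_discrepancy \<mu> \<phi> \<Theta>\<^sub>0 \<delta> n =
     Sup {ennreal \<bar>(\<integral>x. T x \<partial>data_law \<mu> \<phi> n m) - (\<integral>x. T x \<partial>data_law \<mu> \<phi> n (\<lambda>_. vec_mean n m))\<bar> | T m.
            T \<in> invariant_tests \<mu> n \<and> L2_set (\<lambda>i. m i - vec_mean n m) {..<n} \<le> \<delta> \<and>
            (\<forall>i<n. m i \<in> \<Theta>\<^sub>0) \<and> vec_mean n m \<in> \<Theta>\<^sub>0}"

end

theory Submission
  imports Defs
begin

text \<open>
  Fix \<open>m\<close> with mean \<open>b\<close>, put \<open>\<theta>\<^sub>i = m\<^sub>i - b\<close>, and let \<open>P\<close> be the law of one observation at \<open>b\<close>, with
  \<open>r\<^sub>i\<close> the density of the law at \<open>m\<^sub>i\<close> with respect to \<open>P\<close>. A permutation-invariant test cannot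
  tell which observation carries which parameter, so it sees the product law under \<open>m\<close> only through
  the average of \<open>\<Prod>\<^sub>i r\<^sub>\<pi>\<^sub>(\<^sub>i\<^sub>)(x\<^sub>i)\<close> over all permutations \<open>\<pi>\<close>. The claim is that this average is close
  to \<open>1\<close> in \<open>L\<^sup>1(P\<^sup>n)\<close>.

  The \<open>r\<^sub>i\<close> may fail to be square integrable, so they are replaced by \<open>g\<^sub>i = min r\<^sub>i K\<close>. Testing both
  \<open>T\<close> and \<open>1 - T\<close>, minorants \<open>g\<^sub>i \<le> r\<^sub>i\<close> suffice (lemma \<open>invariant_test_discrepancy_le\<close>), and the lost
  mass \<open>\<Sum>\<^sub>i (1 - E g\<^sub>i)\<close> is at most \<open>C \<delta>\<^sup>2 / (ln K)\<^sup>2\<close> by Chebyshev's inequality for the log ratio under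
  \<open>m\<^sub>i\<close>, where \<open>C\<close> bounds the second moments of the difference quotients of the log density
  (lemma \<open>trunc_ratio_mean\<close>). For the truncated average the second moment can be computed. With
  \<open>h\<^sub>i = g\<^sub>i - 1\<close> and \<open>c\<^sub>i\<^sub>j = E h\<^sub>i h\<^sub>j\<close> it is at most the average over \<open>\<pi>\<close> of \<open>exp S\<^sub>\<pi>\<close>, where
  \<open>S\<^sub>\<pi> = \<Sum>\<^sub>i c\<^sub>i\<^sub>\<pi>\<^sub>(\<^sub>i\<^sub>)\<close>. As \<open>c\<close> is a Gram matrix with trace at most \<open>B = K\<^sup>2 C \<delta>\<^sup>2\<close>, every \<open>S\<^sub>\<pi>\<close> is at
  most \<open>B\<close>, and the mean and the second moment of \<open>S\<^sub>\<pi>\<close> over \<open>\<pi>\<close> are controlled by \<open>B\<^sup>2 / n\<close> and by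
  \<open>d = E (\<Sum>\<^sub>i h\<^sub>i)\<^sup>2 / n\<close> (lemma \<open>perm_avg_prod_L1_le\<close>).

  It remains to see that \<open>d\<close> is small. Uniformly over the compact parameter set, \<open>h\<^sub>i\<close> equals
  \<open>\<theta>\<^sub>i \<phi>\<^sub>1(\<cdot>, b)\<close> up to an error of \<open>L\<^sup>2\<close> norm \<open>o(\<theta>\<^sub>i)\<close> (lemma \<open>uniform_score_approximation\<close>). Since
  \<open>\<Sum>\<^sub>i \<theta>\<^sub>i = 0\<close>, the linear terms cancel in \<open>\<Sum>\<^sub>i h\<^sub>i\<close>, and the errors contribute \<open>o(1)\<close> to \<open>d\<close>; the at
  most \<open>\<delta>\<^sup>2 / \<eta>\<^sup>2\<close> coordinates with \<open>\<bar>\<theta>\<^sub>i\<bar> \<ge> \<eta>\<close> contribute \<open>O(1 / n)\<close> (lemma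
  \<open>integral_sum_square_le_of_score_approx\<close>). The uniform \<open>L\<^sup>2\<close> expansion holds because the difference
  quotients of the log density converge pointwise and their second moments converge too, by the
  continuity of the quotient laws in the Wasserstein topology.
\<close>

section \<open>Moments of sums over a random permutation\<close>

text \<open>
  Every entry of a uniformly random permutation is uniformly distributed: by symmetry the sum over
  \<open>\<pi>\<close> is the same for all \<open>i\<close>, and summed over \<open>i\<close> it visits each point once per permutation.
\<close>

lemma card_mult_sum_permutes_apply:
  fixes f :: "'i \<Rightarrow> real"
  assumes "finite I" "i \<in> I"
  shows "card I * (\<Sum>\<pi> | \<pi> permutes I. f (\<pi> i)) = fact (card I) * (\<Sum>j\<in>I. f j)"
proof -
  have "(\<Sum>\<pi> | \<pi> permutes I. f (\<pi> k)) = (\<Sum>\<pi> | \<pi> permutes I. f (\<pi> i))" if "k \<in> I" for k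
  proof -
    have "Transposition.transpose i k permutes I"
      using assms that by (intro permutes_swap_id)
    from sum_permutations_compose_right[OF this, of "\<lambda>\<pi>. f (\<pi> k)"]
    show ?thesis by simp
  qed
  then have "card I * (\<Sum>\<pi> | \<pi> permutes I. f (\<pi> i)) = (\<Sum>k\<in>I. \<Sum>\<pi> | \<pi> permutes I. f (\<pi> k))"
    by simp
  also have "\<dots> = (\<Sum>\<pi> | \<pi> permutes I. \<Sum>k\<in>I. f (\<pi> k))"
    by (rule sum.swap)
  also have "\<dots> = (\<Sum>\<pi> | \<pi> permutes I. \<Sum>j\<in>I. f j)"
    by (intro sum.cong refl sum.permute[symmetric, unfolded comp_def]) simp
  also have "\<dots> = fact (card I) * (\<Sum>j\<in>I. f j)"
    using card_permutations[OF refl assms(1)] by simp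
  finally show ?thesis .
qed

text \<open>
  The same symmetry argument for two distinct entries, using that the permutations act transitively
  on ordered pairs of distinct points.
\<close>

lemma card_mult_sum_permutes_apply2:
  fixes F :: "'i \<Rightarrow> 'i \<Rightarrow> real"
  assumes I: "finite I" and ik: "i \<in> I" "k \<in> I" "i \<noteq> k"
  shows "card I * (real (card I) - 1) * (\<Sum>\<pi> | \<pi> permutes I. F (\<pi> i) (\<pi> k)) =
         fact (card I) * (\<Sum>j\<in>I. \<Sum>l\<in>I - {j}. F j l)"
proof -
  have eq: "(\<Sum>\<pi> | \<pi> permutes I. F (\<pi> i') (\<pi> k')) = (\<Sum>\<pi> | \<pi> permutes I. F (\<pi> i) (\<pi> k))"
    if "i' \<in> I" "k' \<in> I - {i'}" for i' k'
  proof -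
    \<comment> \<open>\<open>t\<close> is where the first transposition sends \<open>k\<close>, so \<open>\<tau>\<close> maps \<open>(i, k)\<close> to \<open>(i', k')\<close>.\<close>
    define t where "t = Transposition.transpose i i' k"
    define \<tau> where "\<tau> = Transposition.transpose t k' \<circ> Transposition.transpose i i'"
    have t: "t \<in> I" "t \<noteq> i'"
      using ik that by (auto simp: t_def Transposition.transpose_def)
    have "\<tau> permutes I"
      unfolding \<tau>_def using ik that t
      by (intro permutes_compose permutes_swap_id) auto
    moreover have "\<tau> i = i'" "\<tau> k = k'"
      using ik that t by (auto simp: \<tau>_def t_def[symmetric] Transposition.transpose_def[of t])
    ultimately show ?thesis
      using sum_permutations_compose_right[of \<tau> I "\<lambda>\<pi>. F (\<pi> i) (\<pi> k)"] by simp
  qed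
  have "card I * (real (card I) - 1) * (\<Sum>\<pi> | \<pi> permutes I. F (\<pi> i) (\<pi> k)) =
      (\<Sum>i'\<in>I. \<Sum>k'\<in>I - {i'}. \<Sum>\<pi> | \<pi> permutes I. F (\<pi> i) (\<pi> k))"
  proof -
    have "real (card (I - {i'})) = real (card I) - 1" if "i' \<in> I" for i'
    proof -
      have "card I > 0" using that I by (auto simp: card_gt_0_iff)
      then show ?thesis using that I by (simp add: of_nat_diff)
    qed
    then show ?thesis by simp
  qed
  also have "\<dots> = (\<Sum>i'\<in>I. \<Sum>k'\<in>I - {i'}. \<Sum>\<pi> | \<pi> permutes I. F (\<pi> i') (\<pi> k'))"
    by (intro sum.cong refl eq[symmetric])
  also have "\<dots> = (\<Sum>i'\<in>I. \<Sum>\<pi> | \<pi> permutes I. \<Sum>k'\<in>I - {i'}. F (\<pi> i') (\<pi> k'))"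
    by (intro sum.cong refl sum.swap)
  also have "\<dots> = (\<Sum>\<pi> | \<pi> permutes I. \<Sum>i'\<in>I. \<Sum>k'\<in>I - {i'}. F (\<pi> i') (\<pi> k'))"
    by (rule sum.swap)
  also have "\<dots> = (\<Sum>\<pi> | \<pi> permutes I. \<Sum>j\<in>I. \<Sum>l\<in>I - {j}. F j l)"
  proof (rule sum.cong[OF refl])
    fix \<pi> assume "\<pi> \<in> {\<pi>. \<pi> permutes I}"
    then have \<pi>: "\<pi> permutes I" by simp
    have "(\<Sum>k'\<in>I - {i'}. F (\<pi> i') (\<pi> k')) = (\<Sum>l\<in>I - {\<pi> i'}. F (\<pi> i') l)" if "i' \<in> I" for i'
      by (rule sum.reindex_bij_betw)
        (use \<pi> that in \<open>auto intro!: bij_betw_DiffI simp: permutes_imp_bij permutes_in_image\<close>)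
    then have "(\<Sum>i'\<in>I. \<Sum>k'\<in>I - {i'}. F (\<pi> i') (\<pi> k')) = (\<Sum>i'\<in>I. \<Sum>l\<in>I - {\<pi> i'}. F (\<pi> i') l)"
      by simp
    also have "\<dots> = (\<Sum>j\<in>I. \<Sum>l\<in>I - {j}. F j l)"
      by (rule sum.reindex_bij_betw) (rule permutes_imp_bij[OF \<pi>])
    finally show "(\<Sum>i'\<in>I. \<Sum>k'\<in>I - {i'}. F (\<pi> i') (\<pi> k')) = (\<Sum>j\<in>I. \<Sum>l\<in>I - {j}. F j l)" .
  qed
  also have "\<dots> = fact (card I) * (\<Sum>j\<in>I. \<Sum>l\<in>I - {j}. F j l)"
    using card_permutations[OF refl I] by simp
  finally show ?thesis .
qed

text \<open>
  By inclusion-exclusion the difference of the right-hand and the left-hand side is the sum of the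
  squares of the row sums and of the column sums of \<open>c\<close>.
\<close>

lemma sum_off_diagonal_pairs_le:
  fixes c :: "'i \<Rightarrow> 'i \<Rightarrow> real"
  assumes I: "finite I"
  shows "(\<Sum>i\<in>I. \<Sum>k\<in>I - {i}. \<Sum>j\<in>I. \<Sum>l\<in>I - {j}. c i j * c k l)
     \<le> (\<Sum>i\<in>I. \<Sum>j\<in>I. c i j)\<^sup>2 + (\<Sum>i\<in>I. \<Sum>j\<in>I. (c i j)\<^sup>2)"
proof -
  define R where "R i = (\<Sum>j\<in>I. c i j)" for i
  define C where "C j = (\<Sum>i\<in>I. c i j)" for j
  define D where "D = (\<Sum>i\<in>I. \<Sum>j\<in>I. c i j)"
  have D_R: "D = (\<Sum>i\<in>I. R i)" and D_C: "D = (\<Sum>j\<in>I. C j)"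
    unfolding D_def R_def C_def by (rule refl, rule sum.swap)
  have inner: "(\<Sum>k\<in>I - {i}. \<Sum>l\<in>I - {j}. c k l) = D - R i - C j + c i j"
    if "i \<in> I" "j \<in> I" for i j
    using that I by (simp add: sum_diff1 sum_subtractf D_R R_def[symmetric] C_def[symmetric])
  have "(\<Sum>i\<in>I. \<Sum>k\<in>I - {i}. \<Sum>j\<in>I. \<Sum>l\<in>I - {j}. c i j * c k l) =
      (\<Sum>i\<in>I. \<Sum>j\<in>I. c i j * (\<Sum>k\<in>I - {i}. \<Sum>l\<in>I - {j}. c k l))"
    unfolding sum_distrib_left by (intro sum.cong refl sum.swap)
  also have "\<dots> = (\<Sum>i\<in>I. \<Sum>j\<in>I. c i j * (D - R i - C j + c i j))"
    by (intro sum.cong refl) (simp add: inner)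
  also have "\<dots> = (\<Sum>i\<in>I. \<Sum>j\<in>I. D * c i j) - (\<Sum>i\<in>I. \<Sum>j\<in>I. R i * c i j)
      - (\<Sum>i\<in>I. \<Sum>j\<in>I. C j * c i j) + (\<Sum>i\<in>I. \<Sum>j\<in>I. (c i j)\<^sup>2)"
    by (simp add: sum.distrib sum_subtractf algebra_simps power2_eq_square)
  also have "(\<Sum>i\<in>I. \<Sum>j\<in>I. C j * c i j) = (\<Sum>j\<in>I. (C j)\<^sup>2)"
    by (subst sum.swap) (simp add: C_def power2_eq_square flip: sum_distrib_left)
  also have "(\<Sum>i\<in>I. \<Sum>j\<in>I. R i * c i j) = (\<Sum>i\<in>I. (R i)\<^sup>2)"
    by (simp add: R_def power2_eq_square flip: sum_distrib_left)
  also have "(\<Sum>i\<in>I. \<Sum>j\<in>I. D * c i j) = D\<^sup>2"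
    by (simp add: D_def power2_eq_square flip: sum_distrib_left)
  finally show ?thesis
    using sum_nonneg[of I "\<lambda>i. (R i)\<^sup>2"] sum_nonneg[of I "\<lambda>i. (C i)\<^sup>2"]
    by (simp add: D_def)
qed

text \<open>
  The second moment of the permutation statistic \<open>S\<^sub>\<pi> = \<Sum>\<^sub>i c\<^sub>i\<^sub>\<pi>\<^sub>(\<^sub>i\<^sub>)\<close>. Expanding the square, the diagonal terms
  average to \<open>\<Sum> c\<^sup>2 / n\<close>, and each pair of different entries carries the weight \<open>1 / (n (n - 1))\<close>.
\<close>

lemma sum_permutes_square_le:
  fixes c :: "'i \<Rightarrow> 'i \<Rightarrow> real"
  assumes I: "finite I" and n: "card I \<ge> 2"
  defines "n \<equiv> real (card I)"
  shows "(\<Sum>\<pi> | \<pi> permutes I. (\<Sum>i\<in>I. c i (\<pi> i))\<^sup>2) / fact (card I)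
     \<le> 2 * (\<Sum>i\<in>I. \<Sum>j\<in>I. (c i j)\<^sup>2) / n + 2 * ((\<Sum>i\<in>I. \<Sum>j\<in>I. c i j) / n)\<^sup>2"
proof -
  define D where "D = (\<Sum>i\<in>I. \<Sum>j\<in>I. c i j)"
  define V where "V = (\<Sum>i\<in>I. \<Sum>j\<in>I. (c i j)\<^sup>2)"
  define N where "N = (fact (card I) :: real)"
  have n2: "n \<ge> 2" using n by (simp add: n_def)
  have N: "N > 0" by (simp add: N_def)
  have V: "V \<ge> 0" by (simp add: V_def sum_nonneg)
  have diag: "(\<Sum>\<pi> | \<pi> permutes I. (c i (\<pi> i))\<^sup>2) = N / n * (\<Sum>j\<in>I. (c i j)\<^sup>2)" if "i \<in> I" for i
    using card_mult_sum_permutes_apply[OF I that, of "\<lambda>j. (c i j)\<^sup>2"] n2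
    by (simp add: n_def N_def field_simps)
  have off: "(\<Sum>\<pi> | \<pi> permutes I. c i (\<pi> i) * c k (\<pi> k)) =
      N / (n * (n - 1)) * (\<Sum>j\<in>I. \<Sum>l\<in>I - {j}. c i j * c k l)" if "i \<in> I" "k \<in> I - {i}" for i k
  proof -
    have "i \<in> I" "k \<in> I" "i \<noteq> k" using that by auto
    from card_mult_sum_permutes_apply2[OF I this, of "\<lambda>j l. c i j * c k l"] n2 show ?thesis
      by (simp add: n_def[symmetric] N_def field_simps)
  qed
  have "(\<Sum>\<pi> | \<pi> permutes I. (\<Sum>i\<in>I. c i (\<pi> i))\<^sup>2) =
      (\<Sum>\<pi> | \<pi> permutes I. \<Sum>i\<in>I. \<Sum>k\<in>I. c i (\<pi> i) * c k (\<pi> k))"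
    by (simp add: power2_eq_square sum_product)
  also have "\<dots> = (\<Sum>\<pi> | \<pi> permutes I. \<Sum>i\<in>I. (c i (\<pi> i))\<^sup>2 + (\<Sum>k\<in>I - {i}. c i (\<pi> i) * c k (\<pi> k)))"
    by (intro sum.cong refl) (simp add: sum.remove[OF I] power2_eq_square)
  also have "\<dots> = (\<Sum>i\<in>I. \<Sum>\<pi> | \<pi> permutes I. (c i (\<pi> i))\<^sup>2 + (\<Sum>k\<in>I - {i}. c i (\<pi> i) * c k (\<pi> k)))"
    by (rule sum.swap)
  also have "\<dots> = (\<Sum>i\<in>I. (\<Sum>\<pi> | \<pi> permutes I. (c i (\<pi> i))\<^sup>2) +
      (\<Sum>\<pi> | \<pi> permutes I. \<Sum>k\<in>I - {i}. c i (\<pi> i) * c k (\<pi> k)))"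
    by (simp only: sum.distrib)
  also have "\<dots> = (\<Sum>i\<in>I. (\<Sum>\<pi> | \<pi> permutes I. (c i (\<pi> i))\<^sup>2) +
      (\<Sum>k\<in>I - {i}. \<Sum>\<pi> | \<pi> permutes I. c i (\<pi> i) * c k (\<pi> k)))"
    by (intro sum.cong refl arg_cong2[where f="(+)"] sum.swap)
  also have "\<dots> = (\<Sum>i\<in>I. N / n * (\<Sum>j\<in>I. (c i j)\<^sup>2) +
      (\<Sum>k\<in>I - {i}. N / (n * (n - 1)) * (\<Sum>j\<in>I. \<Sum>l\<in>I - {j}. c i j * c k l)))"
    by (intro sum.cong refl arg_cong2[where f="(+)"] diag off)
  also have "\<dots> = N / n * V + N / (n * (n - 1)) *
      (\<Sum>i\<in>I. \<Sum>k\<in>I - {i}. \<Sum>j\<in>I. \<Sum>l\<in>I - {j}. c i j * c k l)"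
    unfolding V_def by (simp add: sum.distrib sum_distrib_left)
  also have "\<dots> \<le> N / n * V + N / (n * (n - 1)) * (D\<^sup>2 + V)"
    unfolding D_def V_def using n2 N
    by (intro add_left_mono mult_left_mono sum_off_diagonal_pairs_le I) auto
  also have "\<dots> \<le> N * (2 * V / n + 2 * (D / n)\<^sup>2)"
  proof -
    have *: "1 / (n * (n - 1)) \<le> 1 / n" "1 / (n * (n - 1)) \<le> 2 / n\<^sup>2"
      using n2 by (auto simp: divide_simps power2_eq_square algebra_simps)
    have "1 / (n * (n - 1)) * V \<le> 1 / n * V" "1 / (n * (n - 1)) * D\<^sup>2 \<le> 2 / n\<^sup>2 * D\<^sup>2"
      by (rule mult_right_mono[OF *(1) V], rule mult_right_mono[OF *(2)]) simp
    then have "V / n + 1 / (n * (n - 1)) * (D\<^sup>2 + V) \<le> 2 * V / n + 2 * (D / n)\<^sup>2"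
      by (simp add: distrib_left power_divide)
    from mult_left_mono[OF this, of N] N show ?thesis
      by (simp add: distrib_left)
  qed
  finally have "(\<Sum>\<pi> | \<pi> permutes I. (\<Sum>i\<in>I. c i (\<pi> i))\<^sup>2) / N \<le> 2 * V / n + 2 * (D / n)\<^sup>2"
    using N by (simp add: divide_le_eq mult.commute)
  then show ?thesis unfolding N_def V_def D_def .
qed

lemma exp_le_quadratic:
  fixes s :: real
  assumes "s \<le> B" "0 \<le> B"
  shows "exp s \<le> 1 + s + exp B * s\<^sup>2"
proof -
  obtain t where t: "\<bar>t\<bar> \<le> \<bar>s\<bar>" "exp s = (\<Sum>m<2. (s ^ m) / fact m) + (exp t / fact 2) * s ^ 2"
    using Maclaurin_exp_le by blast
  show ?thesis
  proof (cases "s \<ge> 0")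
    case True
    then have "exp t \<le> exp B" using t(1) assms by simp
    moreover have "exp t / 2 \<le> exp t" by simp
    ultimately have "exp t / 2 \<le> exp B" by linarith
    then have "exp t / 2 * s\<^sup>2 \<le> exp B * s\<^sup>2" by (intro mult_right_mono) auto
    then show ?thesis using t(2) by (simp add: numeral_2_eq_2)
  next
    case False
    \<comment> \<open>Invert the lower bound \<open>1 + x + x\<^sup>2 / 2 \<le> exp x\<close>.\<close>
    define x where "x = - s"
    have x: "x \<ge> 0" using False by (simp add: x_def)
    have "1 \<le> (1 + x + x\<^sup>2 / 2) * (1 - x + x\<^sup>2)"
    proof -
      have "(1 + x + x\<^sup>2 / 2) * (1 - x + x\<^sup>2) = 1 + x\<^sup>2 / 2 + x ^ 3 / 2 + x ^ 4 / 2"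
        by (simp add: field_simps power2_eq_square power3_eq_cube power4_eq_xxxx)
      then show ?thesis using x by simp
    qed
    also have "\<dots> \<le> exp x * (1 - x + x\<^sup>2)"
    proof (intro mult_right_mono exp_lower_Taylor_quadratic x)
      have "1 - x + x\<^sup>2 = (x - 1/2)\<^sup>2 + 3/4" by (simp add: power2_eq_square algebra_simps)
      then show "0 \<le> 1 - x + x\<^sup>2" by simp
    qed
    finally have "exp s \<le> 1 + s + s\<^sup>2"
      by (simp add: x_def exp_minus field_simps)
    also have "s\<^sup>2 \<le> exp B * s\<^sup>2"
      using assms mult_right_mono[of 1 "exp B" "s\<^sup>2"] by simp
    finally show ?thesis by simp
  qed
qed

text \<open>
  An upper bound on the values of \<open>S\<^sub>\<pi>\<close> is enough to replace the exponential by a quadratic.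
\<close>

lemma permutes_average_exp_le:
  fixes c :: "'i \<Rightarrow> 'i \<Rightarrow> real"
  assumes I: "finite I" and n: "card I \<ge> 2"
    and B: "\<And>\<pi>. \<pi> permutes I \<Longrightarrow> (\<Sum>i\<in>I. c i (\<pi> i)) \<le> B" "0 \<le> B"
  defines "n \<equiv> real (card I)"
  defines "d \<equiv> (\<Sum>i\<in>I. \<Sum>j\<in>I. c i j) / n"
  shows "(\<Sum>\<pi> | \<pi> permutes I. exp (\<Sum>i\<in>I. c i (\<pi> i))) / fact (card I)
     \<le> 1 + d + exp B * (2 * (\<Sum>i\<in>I. \<Sum>j\<in>I. (c i j)\<^sup>2) / n + 2 * d\<^sup>2)"
proof -
  define S where "S \<pi> = (\<Sum>i\<in>I. c i (\<pi> i))" for \<pi>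
  have "(\<Sum>\<pi> | \<pi> permutes I. S \<pi>) = (\<Sum>i\<in>I. \<Sum>\<pi> | \<pi> permutes I. c i (\<pi> i))"
    unfolding S_def by (rule sum.swap)
  also have "\<dots> = (\<Sum>i\<in>I. fact (card I) / n * (\<Sum>j\<in>I. c i j))"
    using card_mult_sum_permutes_apply[OF I] n
    by (intro sum.cong refl) (simp add: n_def field_simps)
  also have "\<dots> = fact (card I) * d"
    by (simp add: d_def sum_distrib_left sum_divide_distrib)
  finally have S: "(\<Sum>\<pi> | \<pi> permutes I. S \<pi>) = fact (card I) * d" .
  have "(\<Sum>\<pi> | \<pi> permutes I. exp (S \<pi>)) \<le> (\<Sum>\<pi> | \<pi> permutes I. 1 + S \<pi> + exp B * (S \<pi>)\<^sup>2)"
    by (intro sum_mono exp_le_quadratic) (use B in \<open>auto simp: S_def\<close>)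
  also have "\<dots> = fact (card I) + fact (card I) * d + exp B * (\<Sum>\<pi> | \<pi> permutes I. (S \<pi>)\<^sup>2)"
    using card_permutations[OF refl I] by (simp add: sum.distrib S sum_distrib_left)
  finally have "(\<Sum>\<pi> | \<pi> permutes I. exp (S \<pi>)) / fact (card I) \<le>
      1 + d + exp B * ((\<Sum>\<pi> | \<pi> permutes I. (S \<pi>)\<^sup>2) / fact (card I))"
    by (simp add: divide_simps algebra_simps)
  also have "\<dots> \<le> 1 + d + exp B * (2 * (\<Sum>i\<in>I. \<Sum>j\<in>I. (c i j)\<^sup>2) / n + 2 * d\<^sup>2)"
    unfolding S_def d_def n_def
    by (intro add_left_mono mult_left_mono sum_permutes_square_le I n) auto
  finally show ?thesis unfolding S_def .
qed

section \<open>Products averaged over permutations\<close>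

definition perm_avg_prod :: "'i set \<Rightarrow> ('i \<Rightarrow> 'a \<Rightarrow> real) \<Rightarrow> ('i \<Rightarrow> 'a) \<Rightarrow> real" where
  "perm_avg_prod I g x = (\<Sum>\<pi> | \<pi> permutes I. \<Prod>i\<in>I. g (\<pi> i) (x i)) / fact (card I)"

lemma iid_product_prob_space:
  "prob_space P \<Longrightarrow> product_prob_space (\<lambda>_. P)"
  by (intro product_prob_spaceI)

lemma integral_PiM_prod:
  fixes f :: "'i \<Rightarrow> 'a \<Rightarrow> real"
  assumes "prob_space P" "finite I" "\<And>i. i \<in> I \<Longrightarrow> integrable P (f i)"
  shows "integrable (PiM I (\<lambda>_. P)) (\<lambda>x. \<Prod>i\<in>I. f i (x i))"
    and "(\<integral>x. (\<Prod>i\<in>I. f i (x i)) \<partial>PiM I (\<lambda>_. P)) = (\<Prod>i\<in>I. integral\<^sup>L P (f i))"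
proof -
  interpret product_prob_space "\<lambda>_. P" I using assms(1) by (rule iid_product_prob_space)
  show "integrable (PiM I (\<lambda>_. P)) (\<lambda>x. \<Prod>i\<in>I. f i (x i))"
    using assms by (intro product_integrable_prod) auto
  show "(\<integral>x. (\<Prod>i\<in>I. f i (x i)) \<partial>PiM I (\<lambda>_. P)) = (\<Prod>i\<in>I. integral\<^sup>L P (f i))"
    using assms by (intro product_integral_prod) auto
qed

lemma integral_perm_avg_prod:
  fixes g :: "'i \<Rightarrow> 'a \<Rightarrow> real"
  assumes P: "prob_space P" and I: "finite I" and g: "\<And>i. i \<in> I \<Longrightarrow> integrable P (g i)"
  shows "integrable (PiM I (\<lambda>_. P)) (perm_avg_prod I g)"
    and "(\<integral>x. perm_avg_prod I g x \<partial>PiM I (\<lambda>_. P)) = (\<Prod>i\<in>I. integral\<^sup>L P (g i))"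
proof -
  have int: "integrable (PiM I (\<lambda>_. P)) (\<lambda>x. \<Prod>i\<in>I. g (\<pi> i) (x i))" (is "?A \<pi>")
    and eq: "(\<integral>x. (\<Prod>i\<in>I. g (\<pi> i) (x i)) \<partial>PiM I (\<lambda>_. P)) = (\<Prod>i\<in>I. integral\<^sup>L P (g i))" (is "?B \<pi>")
    if "\<pi> permutes I" for \<pi>
  proof -
    have g': "integrable P (g (\<pi> i))" if "i \<in> I" for i
      using g \<open>\<pi> permutes I\<close> that by (simp add: permutes_in_image)
    then show "?A \<pi>" by (intro integral_PiM_prod P I)
    have "(\<Prod>i\<in>I. integral\<^sup>L P (g i)) = (\<Prod>i\<in>I. integral\<^sup>L P (g (\<pi> i)))"
      using prod.permute[OF \<open>\<pi> permutes I\<close>, of "\<lambda>i. integral\<^sup>L P (g i)"] by (simp add: comp_def)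
    then show "?B \<pi>" using integral_PiM_prod(2)[OF P I, of "\<lambda>i. g (\<pi> i)"] g' by simp
  qed
  show "integrable (PiM I (\<lambda>_. P)) (perm_avg_prod I g)"
    unfolding perm_avg_prod_def using int by (intro integrable_divide_zero integrable_sum) auto
  show "(\<integral>x. perm_avg_prod I g x \<partial>PiM I (\<lambda>_. P)) = (\<Prod>i\<in>I. integral\<^sup>L P (g i))"
    unfolding perm_avg_prod_def using card_permutations[OF refl I]
    by (simp add: int eq)
qed

text \<open>
  The square is a double sum over permutations, but the integral of a term depends only on the quotient
  of the two permutations.
\<close>

lemma integral_perm_avg_prod_square:
  fixes g :: "'i \<Rightarrow> 'a \<Rightarrow> real"
  assumes P: "prob_space P" and I: "finite I"
    and g: "\<And>i j. i \<in> I \<Longrightarrow> j \<in> I \<Longrightarrow> integrable P (\<lambda>x. g i x * g j x)"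
  shows "integrable (PiM I (\<lambda>_. P)) (\<lambda>x. (perm_avg_prod I g x)\<^sup>2)"
    and "(\<integral>x. (perm_avg_prod I g x)\<^sup>2 \<partial>PiM I (\<lambda>_. P)) =
      (\<Sum>\<pi> | \<pi> permutes I. \<Prod>i\<in>I. \<integral>x. g i x * g (\<pi> i) x \<partial>P) / fact (card I)"
proof -
  define G where "G \<pi> \<sigma> x = (\<Prod>i\<in>I. g (\<pi> i) (x i) * g (\<sigma> i) (x i))" for \<pi> \<sigma> :: "'i \<Rightarrow> 'i" and x :: "'i \<Rightarrow> 'a"
  define a where "a i j = (\<integral>x. g i x * g j x \<partial>P)" for i j
  let ?S = "{\<pi>. \<pi> permutes I}"
  have sq: "(perm_avg_prod I g x)\<^sup>2 = (\<Sum>\<pi>\<in>?S. \<Sum>\<sigma>\<in>?S. G \<pi> \<sigma> x) / (fact (card I))\<^sup>2" for x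
    unfolding perm_avg_prod_def power_divide
    by (simp add: power2_eq_square sum_product G_def prod.distrib)
  have int: "integrable (PiM I (\<lambda>_. P)) (G \<pi> \<sigma>)" (is "?A \<pi> \<sigma>")
    and eq: "(\<integral>x. G \<pi> \<sigma> x \<partial>PiM I (\<lambda>_. P)) = (\<Prod>i\<in>I. a (\<pi> i) (\<sigma> i))" (is "?B \<pi> \<sigma>")
    if "\<pi> \<in> ?S" "\<sigma> \<in> ?S" for \<pi> \<sigma>
  proof -
    have g': "integrable P (\<lambda>x. g (\<pi> i) x * g (\<sigma> i) x)" if "i \<in> I" for i
      using g \<open>\<pi> \<in> ?S\<close> \<open>\<sigma> \<in> ?S\<close> that by (simp add: permutes_in_image)
    then show "?A \<pi> \<sigma>" unfolding G_def by (intro integral_PiM_prod(1)[where f="\<lambda>i x. g (\<pi> i) x * g (\<sigma> i) x"] P I)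
    show "?B \<pi> \<sigma>" using integral_PiM_prod(2)[OF P I, of "\<lambda>i x. g (\<pi> i) x * g (\<sigma> i) x"] g'
      by (simp add: a_def G_def)
  qed
  show "integrable (PiM I (\<lambda>_. P)) (\<lambda>x. (perm_avg_prod I g x)\<^sup>2)"
    unfolding sq
    by (rule integrable_divide_zero, (rule Bochner_Integration.integrable_sum)+, rule int)
  have avg: "(\<Sum>\<sigma>\<in>?S. \<Prod>i\<in>I. a (\<pi> i) (\<sigma> i)) = (\<Sum>\<tau>\<in>?S. \<Prod>i\<in>I. a i (\<tau> i))" if "\<pi> \<in> ?S" for \<pi>
  proof -
    have \<pi>: "\<pi> permutes I" using that by simp
    have "(\<Sum>\<tau>\<in>?S. \<Prod>i\<in>I. a i (\<tau> i)) = (\<Sum>\<tau>\<in>?S. \<Prod>i\<in>I. a (\<pi> i) (\<tau> (\<pi> i)))"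
      by (rule sum.cong[OF refl], rule prod.permute[OF \<pi>, unfolded comp_def])
    also have "\<dots> = (\<Sum>\<sigma>\<in>?S. \<Prod>i\<in>I. a (\<pi> i) (\<sigma> i))"
      using sum_permutations_compose_right[OF \<pi>, of "\<lambda>\<sigma>. \<Prod>i\<in>I. a (\<pi> i) (\<sigma> i)"] by simp
    finally show ?thesis by simp
  qed
  have "(\<integral>x. (perm_avg_prod I g x)\<^sup>2 \<partial>PiM I (\<lambda>_. P)) =
      (\<Sum>\<pi>\<in>?S. \<Sum>\<sigma>\<in>?S. \<Prod>i\<in>I. a (\<pi> i) (\<sigma> i)) / (fact (card I))\<^sup>2"
  proof -
    have "(\<integral>x. (\<Sum>\<pi>\<in>?S. \<Sum>\<sigma>\<in>?S. G \<pi> \<sigma> x) \<partial>PiM I (\<lambda>_. P)) =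
        (\<Sum>\<pi>\<in>?S. \<Sum>\<sigma>\<in>?S. \<integral>x. G \<pi> \<sigma> x \<partial>PiM I (\<lambda>_. P))"
      by (subst Bochner_Integration.integral_sum, rule Bochner_Integration.integrable_sum, rule int, assumption+)
        (intro sum.cong refl Bochner_Integration.integral_sum int)
    also have "\<dots> = (\<Sum>\<pi>\<in>?S. \<Sum>\<sigma>\<in>?S. \<Prod>i\<in>I. a (\<pi> i) (\<sigma> i))"
      by (intro sum.cong refl eq)
    finally show ?thesis unfolding sq by simp
  qed
  also have "\<dots> = fact (card I) * (\<Sum>\<tau>\<in>?S. \<Prod>i\<in>I. a i (\<tau> i)) / (fact (card I))\<^sup>2"
    using card_permutations[OF refl I] by (simp add: avg)
  also have "\<dots> = (\<Sum>\<pi>\<in>?S. \<Prod>i\<in>I. \<integral>x. g i x * g (\<pi> i) x \<partial>P) / fact (card I)"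
    by (simp add: power2_eq_square a_def)
  finally show "(\<integral>x. (perm_avg_prod I g x)\<^sup>2 \<partial>PiM I (\<lambda>_. P)) =
      (\<Sum>\<pi> | \<pi> permutes I. \<Prod>i\<in>I. \<integral>x. g i x * g (\<pi> i) x \<partial>P) / fact (card I)" .
qed

section \<open>Invariant tests of product laws\<close>

text \<open>
  Both measures agree on boxes.
\<close>

lemma PiM_density_eq:
  fixes r :: "'i \<Rightarrow> 'a \<Rightarrow> real"
  assumes P: "prob_space P" and I: "finite I"
    and r[measurable]: "\<And>i. i \<in> I \<Longrightarrow> r i \<in> borel_measurable P"
    and r0: "\<And>i x. i \<in> I \<Longrightarrow> r i x \<ge> 0"
    and Q: "\<And>i. i \<in> I \<Longrightarrow> prob_space (density P (r i))"
  shows "PiM I (\<lambda>i. density P (r i)) = density (PiM I (\<lambda>_. P)) (\<lambda>x. \<Prod>i\<in>I. r i (x i))"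
proof -
  define M where "M i = (if i \<in> I then density P (r i) else P)" for i
  interpret M: product_prob_space M I
    using P Q by (intro product_prob_spaceI) (auto simp: M_def)
  interpret P: product_prob_space "\<lambda>_. P" I using P by (rule iid_product_prob_space)
  have PiM_M: "PiM I (\<lambda>i. density P (r i)) = PiM I M"
    by (intro PiM_cong) (auto simp: M_def)
  have "density (PiM I (\<lambda>_. P)) (\<lambda>x. \<Prod>i\<in>I. r i (x i)) = PiM I M"
  proof (rule M.PiM_eqI[OF I])
    show "sets (density (PiM I (\<lambda>_. P)) (\<lambda>x. ennreal (\<Prod>i\<in>I. r i (x i)))) = sets (PiM I M)"
      by (simp, intro sets_PiM_cong) (auto simp: M_def)
    fix A assume "\<And>i. i \<in> I \<Longrightarrow> A i \<in> sets (M i)"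
    then have A[measurable]: "A i \<in> sets P" if "i \<in> I" for i
      using that by (auto simp: M_def)
    have "emeasure (density (PiM I (\<lambda>_. P)) (\<lambda>x. ennreal (\<Prod>i\<in>I. r i (x i)))) (Pi\<^sub>E I A) =
        (\<integral>\<^sup>+x. ennreal (\<Prod>i\<in>I. r i (x i)) * indicator (Pi\<^sub>E I A) x \<partial>PiM I (\<lambda>_. P))"
      using I by (intro emeasure_density) (auto intro!: sets_PiM_I_finite)
    also have "\<dots> = (\<integral>\<^sup>+x. (\<Prod>i\<in>I. ennreal (r i (x i)) * indicator (A i) (x i)) \<partial>PiM I (\<lambda>_. P))"
    proof (intro nn_integral_cong)
      fix x assume x: "x \<in> space (PiM I (\<lambda>_. P))"
      have "indicator (Pi\<^sub>E I A) x = (\<Prod>i\<in>I. indicator (A i) (x i) :: ennreal)"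
        using x I by (auto simp: space_PiM PiE_def Pi_def indicator_def prod_zero_iff split: if_splits)
      then show "ennreal (\<Prod>i\<in>I. r i (x i)) * indicator (Pi\<^sub>E I A) x =
          (\<Prod>i\<in>I. ennreal (r i (x i)) * indicator (A i) (x i))"
        by (simp add: prod.distrib prod_ennreal r0)
    qed
    also have "\<dots> = (\<Prod>i\<in>I. \<integral>\<^sup>+x. ennreal (r i x) * indicator (A i) x \<partial>P)"
      by (intro P.product_nn_integral_prod I) auto
    also have "\<dots> = (\<Prod>i\<in>I. emeasure (M i) (A i))"
      by (intro prod.cong refl) (simp add: M_def emeasure_density)
    finally show "emeasure (density (PiM I (\<lambda>_. P)) (\<lambda>x. ennreal (\<Prod>i\<in>I. r i (x i)))) (Pi\<^sub>E I A) =
        (\<Prod>i\<in>I. emeasure (M i) (A i))" .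
  qed
  then show ?thesis by (simp add: PiM_M)
qed

text \<open>
  For an invariant \<open>T\<close> the parameters may be reassigned to the coordinates at will: relabel the
  coordinates, which preserves both the i.i.d. law and \<open>T\<close>.
\<close>

lemma integral_PiM_density_permute:
  fixes r :: "'i \<Rightarrow> 'a \<Rightarrow> real"
  assumes P: "prob_space P" and I: "finite I"
    and r[measurable]: "\<And>i. i \<in> I \<Longrightarrow> r i \<in> borel_measurable P"
    and r0: "\<And>i x. i \<in> I \<Longrightarrow> r i x \<ge> 0"
    and Q: "\<And>i. i \<in> I \<Longrightarrow> prob_space (density P (r i))"
    and T[measurable]: "T \<in> borel_measurable (PiM I (\<lambda>_. P))"
    and inv: "\<And>x \<pi>. x \<in> space (PiM I (\<lambda>_. P)) \<Longrightarrow> \<pi> permutes I \<Longrightarrow> T (x \<circ> \<pi>) = T x"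
    and \<pi>: "\<pi> permutes I"
  shows "(\<integral>x. T x \<partial>PiM I (\<lambda>i. density P (r i))) = (\<integral>x. T x * (\<Prod>i\<in>I. r (\<pi> i) (x i)) \<partial>PiM I (\<lambda>_. P))"
proof -
  define \<tau> where "\<tau> = inv \<pi>"
  have \<tau>: "\<tau> permutes I" unfolding \<tau>_def by (rule permutes_inv[OF \<pi>])
  have \<tau>\<pi>: "\<tau> (\<pi> i) = i" for i unfolding \<tau>_def using permutes_inverses[OF \<pi>] by simp
  let ?P = "PiM I (\<lambda>_. P)"
  define h where "h x = (\<lambda>i\<in>I. x (\<tau> i))" for x :: "'i \<Rightarrow> 'a"
  have h[measurable]: "h \<in> measurable ?P ?P"
    unfolding h_def
    by (intro measurable_restrict measurable_component_singleton) (simp add: permutes_in_image[OF \<tau>])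
  have distr: "distr ?P ?P h = ?P"
    unfolding h_def using distr_PiM_reindex[of I "\<lambda>_. P" \<tau> I] P \<tau>
    by (simp add: permutes_inj_on permutes_in_image Pi_iff)
  have h_eq: "h x = x \<circ> \<tau>" if "x \<in> space ?P" for x
  proof
    fix i show "h x i = (x \<circ> \<tau>) i"
      using that permutes_not_in[OF \<tau>, of i] by (auto simp: h_def space_PiM PiE_def extensional_def)
  qed
  have meas: "(\<lambda>x. \<Prod>i\<in>I. r i (x i)) \<in> borel_measurable ?P" by measurable
  have "(\<integral>x. T x \<partial>PiM I (\<lambda>i. density P (r i))) = (\<integral>x. (\<Prod>i\<in>I. r i (x i)) * T x \<partial>?P)"
    by (subst PiM_density_eq[OF P I r r0 Q], assumption+, subst integral_density)
      (auto intro!: prod_nonneg r0)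
  also have "\<dots> = (\<integral>x. (\<Prod>i\<in>I. r i (x i)) * T x \<partial>distr ?P ?P h)" by (simp add: distr)
  also have "\<dots> = (\<integral>x. (\<Prod>i\<in>I. r i (h x i)) * T (h x) \<partial>?P)"
    by (subst integral_distr) simp_all
  also have "\<dots> = (\<integral>x. T x * (\<Prod>i\<in>I. r (\<pi> i) (x i)) \<partial>?P)"
  proof (intro Bochner_Integration.integral_cong refl)
    fix x assume x: "x \<in> space ?P"
    have "(\<Prod>i\<in>I. r i (h x i)) = (\<Prod>i\<in>I. r (\<pi> i) (h x (\<pi> i)))"
      using prod.permute[OF \<pi>, of "\<lambda>i. r i (h x i)"] by (simp add: comp_def)
    also have "\<dots> = (\<Prod>i\<in>I. r (\<pi> i) (x i))"
      by (intro prod.cong refl) (simp add: h_eq[OF x] \<tau>\<pi>)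
    finally show "(\<Prod>i\<in>I. r i (h x i)) * T (h x) = T x * (\<Prod>i\<in>I. r (\<pi> i) (x i))"
      using inv[OF x \<tau>] by (simp add: h_eq[OF x])
  qed
  finally show ?thesis .
qed

text \<open>
  Averaging the previous identity over \<open>\<pi>\<close> and replacing \<open>r\<close> by its minorant \<open>g\<close> gives
  \<open>E\<^sub>Q T \<ge> E\<^sub>P[T L]\<close>, where \<open>L\<close> is the averaged product of the \<open>g\<^sub>i\<close> and \<open>Q\<close> the law with densities \<open>r\<^sub>i\<close>;
  and \<open>T L \<ge> T - \<bar>L - 1\<bar>\<close> because \<open>0 \<le> T \<le> 1\<close>.
\<close>

lemma integral_invariant_test_ge:
  fixes r g :: "'i \<Rightarrow> 'a \<Rightarrow> real"
  assumes P: "prob_space P" and I: "finite I"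
    and r[measurable]: "\<And>i. i \<in> I \<Longrightarrow> r i \<in> borel_measurable P"
    and g[measurable]: "\<And>i. i \<in> I \<Longrightarrow> g i \<in> borel_measurable P"
    and gr: "\<And>i x. i \<in> I \<Longrightarrow> 0 \<le> g i x" "\<And>i x. i \<in> I \<Longrightarrow> g i x \<le> r i x"
    and Q: "\<And>i. i \<in> I \<Longrightarrow> prob_space (density P (r i))"
    and T[measurable]: "T \<in> borel_measurable (PiM I (\<lambda>_. P))"
    and T01: "\<And>x. x \<in> space (PiM I (\<lambda>_. P)) \<Longrightarrow> T x \<in> {0..1}"
    and inv: "\<And>x \<pi>. x \<in> space (PiM I (\<lambda>_. P)) \<Longrightarrow> \<pi> permutes I \<Longrightarrow> T (x \<circ> \<pi>) = T x"
  shows "(\<integral>x. T x \<partial>PiM I (\<lambda>_. P)) - (\<integral>x. \<bar>perm_avg_prod I g x - 1\<bar> \<partial>PiM I (\<lambda>_. P))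
    \<le> (\<integral>x. T x \<partial>PiM I (\<lambda>i. density P (r i)))"
proof -
  let ?P = "PiM I (\<lambda>_. P)"
  interpret P: prob_space P by fact
  interpret PP: prob_space ?P using P by (intro prob_space_PiM)
  have r0: "0 \<le> r i x" if "i \<in> I" for i x using gr[OF that, of x] by simp
  \<comment> \<open>The densities have total mass \<open>1\<close>.\<close>
  have int_r: "integrable P (r i)" if "i \<in> I" for i
  proof (rule integrableI_nonneg)
    interpret Q: prob_space "density P (r i)" using Q that .
    show "(\<integral>\<^sup>+x. ennreal (r i x) \<partial>P) < \<infinity>"
      using Q.emeasure_space_1 that by (simp add: emeasure_density cong: nn_integral_cong)
  qed (use that r0 in auto)
  have int_g: "integrable P (g i)" if "i \<in> I" for i
    using that gr r0 by (intro Bochner_Integration.integrable_bound[OF int_r[OF that]]) auto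
  have int_T: "integrable ?P T"
    by (rule PP.integrable_const_bound[of _ 1]) (use T01 in auto)
  note int_L = integral_perm_avg_prod(1)[OF P I int_g]
  have int_T_mult: "integrable ?P (\<lambda>x. T x * F x)" if "integrable ?P F" for F
    using T01 that
    by (intro Bochner_Integration.integrable_bound[OF that])
       (auto simp: abs_mult intro!: mult_left_le_one_le)
  have le: "(\<integral>x. T x * (\<Prod>i\<in>I. g (\<pi> i) (x i)) \<partial>?P) \<le> (\<integral>x. T x \<partial>PiM I (\<lambda>i. density P (r i)))"
    and int: "integrable ?P (\<lambda>x. T x * (\<Prod>i\<in>I. g (\<pi> i) (x i)))" if \<pi>: "\<pi> permutes I" for \<pi>
  proof -
    have in_I: "\<pi> i \<in> I" if "i \<in> I" for i using \<pi> that by (simp add: permutes_in_image)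
    show int: "integrable ?P (\<lambda>x. T x * (\<Prod>i\<in>I. g (\<pi> i) (x i)))"
      by (intro int_T_mult integral_PiM_prod(1) P I int_g in_I)
    show "(\<integral>x. T x * (\<Prod>i\<in>I. g (\<pi> i) (x i)) \<partial>?P) \<le> (\<integral>x. T x \<partial>PiM I (\<lambda>i. density P (r i)))"
    proof (subst integral_PiM_density_permute[OF P I r r0 Q T inv \<pi>], assumption+, intro integral_mono int)
      show "integrable ?P (\<lambda>x. T x * (\<Prod>i\<in>I. r (\<pi> i) (x i)))"
        by (intro int_T_mult integral_PiM_prod(1) P I int_r in_I)
      fix x assume "x \<in> space ?P"
      then show "T x * (\<Prod>i\<in>I. g (\<pi> i) (x i)) \<le> T x * (\<Prod>i\<in>I. r (\<pi> i) (x i))"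
        using T01 by (intro mult_left_mono prod_mono) (auto simp: in_I gr)
    qed
  qed
  have "(\<integral>x. T x * perm_avg_prod I g x \<partial>?P) =
      (\<Sum>\<pi> | \<pi> permutes I. \<integral>x. T x * (\<Prod>i\<in>I. g (\<pi> i) (x i)) \<partial>?P) / fact (card I)"
    unfolding perm_avg_prod_def using int by (simp add: sum_distrib_left)
  also have "\<dots> \<le> (\<Sum>\<pi> | \<pi> permutes I. \<integral>x. T x \<partial>PiM I (\<lambda>i. density P (r i))) / fact (card I)"
    by (intro divide_right_mono sum_mono le) auto
  also have "\<dots> = (\<integral>x. T x \<partial>PiM I (\<lambda>i. density P (r i)))"
    using card_permutations[OF refl I] by simp
  finally have 1: "(\<integral>x. T x * perm_avg_prod I g x \<partial>?P) \<le> (\<integral>x. T x \<partial>PiM I (\<lambda>i. density P (r i)))" .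
  have "(\<integral>x. T x \<partial>?P) - (\<integral>x. \<bar>perm_avg_prod I g x - 1\<bar> \<partial>?P) =
      (\<integral>x. T x - \<bar>perm_avg_prod I g x - 1\<bar> \<partial>?P)"
    using int_T int_L by simp
  also have "\<dots> \<le> (\<integral>x. T x * perm_avg_prod I g x \<partial>?P)"
  proof (intro integral_mono int_T_mult int_L)
    show "integrable ?P (\<lambda>x. T x - \<bar>perm_avg_prod I g x - 1\<bar>)"
      using int_T int_L by auto
    fix x assume "x \<in> space ?P"
    then have T: "0 \<le> T x" "T x \<le> 1" using T01 by auto
    have "T x * (1 - perm_avg_prod I g x) \<le> T x * \<bar>perm_avg_prod I g x - 1\<bar>"
      using T by (intro mult_left_mono) auto
    also have "\<dots> \<le> 1 * \<bar>perm_avg_prod I g x - 1\<bar>"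
      using T by (intro mult_right_mono) auto
    finally show "T x - \<bar>perm_avg_prod I g x - 1\<bar> \<le> T x * perm_avg_prod I g x"
      by (simp add: algebra_simps)
  qed
  finally show ?thesis using 1 by simp
qed

text \<open>
  The one-sided bound, applied to \<open>T\<close> and to \<open>1 - T\<close>.
\<close>

lemma invariant_test_discrepancy_le:
  fixes r g :: "'i \<Rightarrow> 'a \<Rightarrow> real"
  assumes P: "prob_space P" and I: "finite I"
    and r[measurable]: "\<And>i. i \<in> I \<Longrightarrow> r i \<in> borel_measurable P"
    and g[measurable]: "\<And>i. i \<in> I \<Longrightarrow> g i \<in> borel_measurable P"
    and gr: "\<And>i x. i \<in> I \<Longrightarrow> 0 \<le> g i x" "\<And>i x. i \<in> I \<Longrightarrow> g i x \<le> r i x"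
    and Q: "\<And>i. i \<in> I \<Longrightarrow> prob_space (density P (r i))"
    and T[measurable]: "T \<in> borel_measurable (PiM I (\<lambda>_. P))"
    and T01: "\<And>x. x \<in> space (PiM I (\<lambda>_. P)) \<Longrightarrow> T x \<in> {0..1}"
    and inv: "\<And>x \<pi>. x \<in> space (PiM I (\<lambda>_. P)) \<Longrightarrow> \<pi> permutes I \<Longrightarrow> T (x \<circ> \<pi>) = T x"
  shows "\<bar>(\<integral>x. T x \<partial>PiM I (\<lambda>i. density P (r i))) - (\<integral>x. T x \<partial>PiM I (\<lambda>_. P))\<bar>
    \<le> (\<integral>x. \<bar>perm_avg_prod I g x - 1\<bar> \<partial>PiM I (\<lambda>_. P))"
proof -
  let ?P = "PiM I (\<lambda>_. P)" and ?Q = "PiM I (\<lambda>i. density P (r i))"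
  interpret PP: prob_space ?P using P by (intro prob_space_PiM)
  interpret QQ: prob_space ?Q using Q by (intro prob_space_PiM)
  have sets_eq: "sets ?Q = sets ?P" by (intro sets_PiM_cong) auto
  then have space_eq: "space ?Q = space ?P" by (rule sets_eq_imp_space_eq)
  have [measurable]: "T \<in> borel_measurable ?Q"
    using T by (simp add: measurable_cong_sets[OF sets_eq refl])
  have int_P: "integrable ?P T"
    by (rule PP.integrable_const_bound[of _ 1]) (use T01 in auto)
  have int_Q: "integrable ?Q T"
    by (rule QQ.integrable_const_bound[of _ 1]) (use T01 in \<open>auto simp: space_eq\<close>)
  have "(\<integral>x. 1 - T x \<partial>?P) - (\<integral>x. \<bar>perm_avg_prod I g x - 1\<bar> \<partial>?P) \<le> (\<integral>x. 1 - T x \<partial>?Q)"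
    by (rule integral_invariant_test_ge[OF P I r g gr Q]) (use T01 inv in auto)
  moreover have "(\<integral>x. T x \<partial>?P) - (\<integral>x. \<bar>perm_avg_prod I g x - 1\<bar> \<partial>?P) \<le> (\<integral>x. T x \<partial>?Q)"
    by (rule integral_invariant_test_ge[OF P I r g gr Q T T01 inv])
  ultimately show ?thesis
    using int_P int_Q by (simp add: PP.prob_space QQ.prob_space)
qed

section \<open>Distance of the averaged product from one\<close>

text \<open>
  The Cauchy-Schwarz inequality for the Bochner integral: a nonnegative quadratic form has a
  nonnegative determinant.
\<close>

lemma integral_mult_squared_le:
  fixes f g :: "'a \<Rightarrow> real"
  assumes f2: "integrable M (\<lambda>x. (f x)\<^sup>2)" and g2: "integrable M (\<lambda>x. (g x)\<^sup>2)"
    and fg: "integrable M (\<lambda>x. f x * g x)"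
  shows "(\<integral>x. f x * g x \<partial>M)\<^sup>2 \<le> (\<integral>x. (f x)\<^sup>2 \<partial>M) * (\<integral>x. (g x)\<^sup>2 \<partial>M)"
proof -
  define a b c where "a = (\<integral>x. (f x)\<^sup>2 \<partial>M)" and "b = (\<integral>x. (g x)\<^sup>2 \<partial>M)" and "c = (\<integral>x. f x * g x \<partial>M)"
  have nonneg: "0 \<le> s\<^sup>2 * a - 2 * s * t * c + t\<^sup>2 * b" for s t
  proof -
    have "0 \<le> (\<integral>x. (s * f x - t * g x)\<^sup>2 \<partial>M)" by simp
    also have "\<dots> = (\<integral>x. s\<^sup>2 * (f x)\<^sup>2 - 2 * s * t * (f x * g x) + t\<^sup>2 * (g x)\<^sup>2 \<partial>M)"
      by (intro Bochner_Integration.integral_cong refl) (simp add: power2_eq_square algebra_simps)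
    also have "\<dots> = s\<^sup>2 * a - 2 * s * t * c + t\<^sup>2 * b"
      using f2 g2 fg by (simp add: a_def b_def c_def)
    finally show ?thesis .
  qed
  have "b \<ge> 0" by (simp add: b_def)
  have "c\<^sup>2 \<le> a * b"
  proof (cases "b = 0")
    case True
    have "c = 0"
    proof (rule ccontr)
      assume "c \<noteq> 0"
      then show False using nonneg[of 1 "(a + 1) / (2 * c)"] True by simp
    qed
    with True show ?thesis by simp
  next
    case False
    have "0 \<le> b * (a * b - c\<^sup>2)"
      using nonneg[of b c] by (simp add: power2_eq_square algebra_simps)
    then show ?thesis using False \<open>b \<ge> 0\<close> by (simp add: zero_le_mult_iff)
  qed
  then show ?thesis by (simp add: a_def b_def c_def)
qed

text \<open>
  The \<open>L\<^sup>2\<close> distance of the averaged product from \<open>1\<close>. Its second moment is an average over \<open>\<pi>\<close> of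
  \<open>\<Prod>\<^sub>i E[g\<^sub>i g\<^sub>\<pi>\<^sub>(\<^sub>i\<^sub>)]\<close>, whose factors are at most \<open>1 + c\<^sub>i\<^sub>\<pi>\<^sub>(\<^sub>i\<^sub>) \<le> exp c\<^sub>i\<^sub>\<pi>\<^sub>(\<^sub>i\<^sub>)\<close> because \<open>E g\<^sub>i \<le> 1\<close>, and its
  mean is \<open>\<Prod>\<^sub>i E g\<^sub>i \<ge> 1 - \<kappa>\<close> by the Weierstrass product inequality.
\<close>

lemma perm_avg_prod_L1_le:
  fixes g :: "'i \<Rightarrow> 'a \<Rightarrow> real"
  assumes P: "prob_space P" and I: "finite I" and n: "card I \<ge> 2"
    and g[measurable]: "\<And>i. i \<in> I \<Longrightarrow> g i \<in> borel_measurable P"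
    and gK: "\<And>i x. i \<in> I \<Longrightarrow> 0 \<le> g i x" "\<And>i x. i \<in> I \<Longrightarrow> g i x \<le> K"
    and g1: "\<And>i. i \<in> I \<Longrightarrow> (\<integral>x. g i x \<partial>P) \<le> 1"
    and B: "(\<Sum>i\<in>I. \<integral>x. (g i x - 1)\<^sup>2 \<partial>P) \<le> B"
    and loss: "(\<Sum>i\<in>I. 1 - (\<integral>x. g i x \<partial>P)) \<le> \<kappa>"
  defines "n \<equiv> real (card I)"
  defines "d \<equiv> (\<integral>x. (\<Sum>i\<in>I. g i x - 1)\<^sup>2 \<partial>P) / n"
  shows "(\<integral>x. \<bar>perm_avg_prod I g x - 1\<bar> \<partial>PiM I (\<lambda>_. P))\<^sup>2
    \<le> 2 * \<kappa> + d + exp B * (2 * B\<^sup>2 / n + 2 * d\<^sup>2)"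
proof -
  interpret P: prob_space P by fact
  interpret PP: prob_space "PiM I (\<lambda>_. P)" using P by (intro prob_space_PiM)
  let ?PP = "PiM I (\<lambda>_. P)"
  define h where "h i x = g i x - 1" for i x
  define c where "c i j = (\<integral>x. h i x * h j x \<partial>P)" for i j
  have h_bound: "\<bar>h i x\<bar> \<le> \<bar>K\<bar> + 1" if "i \<in> I" for i x
    using gK[OF that, of x] by (auto simp: h_def)
  have [measurable]: "h i \<in> borel_measurable P" if "i \<in> I" for i
    unfolding h_def using that by measurable
  have int_h: "integrable P (h i)" if "i \<in> I" for i
    by (rule P.integrable_const_bound[of _ "\<bar>K\<bar> + 1"]) (use h_bound that in auto)
  have int_hh: "integrable P (\<lambda>x. h i x * h j x)" if "i \<in> I" "j \<in> I" for i j
    by (rule P.integrable_const_bound[of _ "(\<bar>K\<bar> + 1) * (\<bar>K\<bar> + 1)"])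
      (use h_bound that in \<open>auto simp: abs_mult intro!: mult_mono\<close>)
  have int_h2: "integrable P (\<lambda>x. (h i x)\<^sup>2)" if "i \<in> I" for i
    using int_hh[OF that that] by (simp add: power2_eq_square)
  have g_h: "g i x = 1 + h i x" for i x by (simp add: h_def)
  have int_g: "integrable P (g i)" if "i \<in> I" for i
    unfolding g_h using int_h[OF that] by simp
  have int_gg: "integrable P (\<lambda>x. g i x * g j x)" if "i \<in> I" "j \<in> I" for i j
    unfolding g_h using int_h int_hh that by (simp add: distrib_left distrib_right)
  have c_diag: "c i i = (\<integral>x. (h i x)\<^sup>2 \<partial>P)" for i
    by (simp add: c_def power2_eq_square)
  have c_nonneg: "c i i \<ge> 0" for i by (simp add: c_diag)
  have sum_diag: "(\<Sum>i\<in>I. c i i) \<le> B"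
    using B by (simp add: c_diag h_def)
  have B0: "0 \<le> B" using sum_nonneg[of I "\<lambda>i. c i i"] c_nonneg sum_diag by simp
  have S_le: "(\<Sum>i\<in>I. c i (\<pi> i)) \<le> B" if \<pi>: "\<pi> permutes I" for \<pi>
  proof -
    have "c i j \<le> (c i i + c j j) / 2" if "i \<in> I" "j \<in> I" for i j
    proof -
      have "c i j \<le> (\<integral>x. ((h i x)\<^sup>2 + (h j x)\<^sup>2) / 2 \<partial>P)"
        unfolding c_def
      proof (intro integral_mono int_hh that)
        show "integrable P (\<lambda>x. ((h i x)\<^sup>2 + (h j x)\<^sup>2) / 2)" using int_h2 that by simp
        show "h i x * h j x \<le> ((h i x)\<^sup>2 + (h j x)\<^sup>2) / 2" for x
          using sum_squares_bound[of "h i x" "h j x"] by simp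
      qed
      also have "\<dots> = (c i i + c j j) / 2" using int_h2 that by (simp add: c_diag)
      finally show ?thesis .
    qed
    then have "(\<Sum>i\<in>I. c i (\<pi> i)) \<le> (\<Sum>i\<in>I. (c i i + c (\<pi> i) (\<pi> i)) / 2)"
      using \<pi> by (intro sum_mono) (simp add: permutes_in_image)
    also have "\<dots> = ((\<Sum>i\<in>I. c i i) + (\<Sum>i\<in>I. c (\<pi> i) (\<pi> i))) / 2"
      by (simp add: sum.distrib flip: sum_divide_distrib)
    also have "(\<Sum>i\<in>I. c (\<pi> i) (\<pi> i)) = (\<Sum>i\<in>I. c i i)"
      using sum.permute[OF \<pi>, of "\<lambda>i. c i i"] by (simp add: comp_def)
    finally show ?thesis using sum_diag by simp
  qed
  have sum_c2: "(\<Sum>i\<in>I. \<Sum>j\<in>I. (c i j)\<^sup>2) \<le> B\<^sup>2"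
  proof -
    have "(\<Sum>i\<in>I. \<Sum>j\<in>I. (c i j)\<^sup>2) \<le> (\<Sum>i\<in>I. \<Sum>j\<in>I. c i i * c j j)"
      unfolding c_diag unfolding c_def
      by (intro sum_mono integral_mult_squared_le int_h2 int_hh)
    also have "\<dots> = (\<Sum>i\<in>I. c i i)\<^sup>2"
      by (simp add: power2_eq_square sum_product)
    also have "\<dots> \<le> B\<^sup>2"
      using sum_diag by (intro power_mono) (auto intro: sum_nonneg c_nonneg)
    finally show ?thesis .
  qed
  have sum_c: "(\<Sum>i\<in>I. \<Sum>j\<in>I. c i j) / n = d"
  proof -
    have "(\<integral>x. (\<Sum>i\<in>I. g i x - 1)\<^sup>2 \<partial>P) = (\<integral>x. (\<Sum>i\<in>I. \<Sum>j\<in>I. h i x * h j x) \<partial>P)"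
      by (simp add: power2_eq_square sum_product h_def)
    also have "\<dots> = (\<Sum>i\<in>I. \<Sum>j\<in>I. c i j)"
      unfolding c_def using int_hh by (simp add: integrable_sum)
    finally show ?thesis by (simp add: d_def)
  qed
  have second_moment: "(\<integral>x. (perm_avg_prod I g x)\<^sup>2 \<partial>?PP) \<le> 1 + d + exp B * (2 * B\<^sup>2 / n + 2 * d\<^sup>2)"
  proof -
    have pair: "(\<integral>x. g i x * g j x \<partial>P) \<le> exp (c i j)" if "i \<in> I" "j \<in> I" for i j
    proof -
      have "(\<integral>x. g i x * g j x \<partial>P) = (\<integral>x. g i x + g j x - 1 + h i x * h j x \<partial>P)"
        by (intro Bochner_Integration.integral_cong refl) (simp add: h_def algebra_simps)
      also have "\<dots> = (\<integral>x. g i x \<partial>P) + (\<integral>x. g j x \<partial>P) - 1 + c i j"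
        using int_g int_hh that by (simp add: c_def P.prob_space)
      also have "\<dots> \<le> 1 + c i j" using g1[OF that(1)] g1[OF that(2)] by simp
      also have "\<dots> \<le> exp (c i j)" by (rule exp_ge_add_one_self)
      finally show ?thesis .
    qed
    have "(\<integral>x. (perm_avg_prod I g x)\<^sup>2 \<partial>?PP) =
        (\<Sum>\<pi> | \<pi> permutes I. \<Prod>i\<in>I. \<integral>x. g i x * g (\<pi> i) x \<partial>P) / fact (card I)"
      by (rule integral_perm_avg_prod_square(2)[OF P I int_gg])
    also have "\<dots> \<le> (\<Sum>\<pi> | \<pi> permutes I. exp (\<Sum>i\<in>I. c i (\<pi> i))) / fact (card I)"
      unfolding exp_sum[OF I]
      by (intro divide_right_mono sum_mono prod_mono)
        (auto simp: permutes_in_image gK intro!: pair Bochner_Integration.integral_nonneg)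
    also have "\<dots> \<le> 1 + d + exp B * (2 * (\<Sum>i\<in>I. \<Sum>j\<in>I. (c i j)\<^sup>2) / n + 2 * d\<^sup>2)"
      using permutes_average_exp_le[where c = c, OF I n S_le B0]
      unfolding n_def[symmetric] sum_c .
    also have "\<dots> \<le> 1 + d + exp B * (2 * B\<^sup>2 / n + 2 * d\<^sup>2)"
      using sum_c2 by (intro add_left_mono mult_left_mono add_right_mono divide_right_mono) (auto simp: n_def)
    finally show ?thesis .
  qed
  have mean: "1 - \<kappa> \<le> (\<integral>x. perm_avg_prod I g x \<partial>?PP)"
  proof -
    have "1 - \<kappa> \<le> 1 - (\<Sum>i\<in>I. 1 - (\<integral>x. g i x \<partial>P))" using loss by simp
    also have "\<dots> \<le> (\<Prod>i\<in>I. 1 - (1 - (\<integral>x. g i x \<partial>P)))"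
      using g1 gK by (intro Weierstrass_prod_ineq) (auto intro!: Bochner_Integration.integral_nonneg)
    also have "\<dots> = (\<integral>x. perm_avg_prod I g x \<partial>?PP)"
      using integral_perm_avg_prod(2)[OF P I int_g] by simp
    finally show ?thesis .
  qed
  note int_L = integral_perm_avg_prod(1)[OF P I int_g]
  note int_L2 = integral_perm_avg_prod_square(1)[OF P I int_gg]
  have sq: "(perm_avg_prod I g x - 1)\<^sup>2 = (perm_avg_prod I g x)\<^sup>2 - 2 * perm_avg_prod I g x + 1" for x
    by (simp add: power2_eq_square algebra_simps)
  have int_sq: "integrable ?PP (\<lambda>x. (perm_avg_prod I g x - 1)\<^sup>2)"
    unfolding sq using int_L int_L2 by simp
  have "(\<integral>x. \<bar>perm_avg_prod I g x - 1\<bar> \<partial>?PP)\<^sup>2 \<le> (\<integral>x. (perm_avg_prod I g x - 1)\<^sup>2 \<partial>?PP)"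
    using integral_mult_squared_le[of ?PP "\<lambda>x. \<bar>perm_avg_prod I g x - 1\<bar>" "\<lambda>_. 1"] int_sq int_L
    by (simp add: PP.prob_space)
  also have "\<dots> = (\<integral>x. (perm_avg_prod I g x)\<^sup>2 \<partial>?PP) - 2 * (\<integral>x. perm_avg_prod I g x \<partial>?PP) + 1"
    unfolding sq using int_L int_L2 by (simp add: PP.prob_space)
  also have "\<dots> \<le> 2 * \<kappa> + d + exp B * (2 * B\<^sup>2 / n + 2 * d\<^sup>2)"
    using second_moment mean by simp
  finally show ?thesis .
qed

text \<open>
  Since the \<open>\<theta>\<^sub>i\<close> sum to zero, \<open>h\<^sub>i\<close> may be replaced by \<open>Z\<^sub>i = h\<^sub>i - \<theta>\<^sub>i \<psi>\<close> in the sum. The Cauchy-Schwarz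
  inequality costs a factor \<open>n\<close> for the coordinates with small \<open>\<theta>\<^sub>i\<close>, where \<open>Z\<^sub>i\<close> is small, and only a
  factor \<open>\<delta>\<^sup>2 / \<eta>\<^sup>2\<close> for the others, which are few.
\<close>

lemma integral_sum_square_le_of_score_approx:
  fixes h :: "'i \<Rightarrow> 'a \<Rightarrow> real" and \<theta> :: "'i \<Rightarrow> real"
  assumes I: "finite I" "I \<noteq> {}"
    and centred: "(\<Sum>i\<in>I. \<theta> i) = 0" and size: "(\<Sum>i\<in>I. (\<theta> i)\<^sup>2) \<le> \<delta>\<^sup>2"
    and int: "\<And>i. i \<in> I \<Longrightarrow> integrable P (\<lambda>x. (h i x - \<theta> i * \<psi> x)\<^sup>2)"
    and meas: "\<And>i. i \<in> I \<Longrightarrow> h i \<in> borel_measurable P"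
    and le: "\<And>i. i \<in> I \<Longrightarrow> (\<integral>x. (h i x - \<theta> i * \<psi> x)\<^sup>2 \<partial>P) \<le> C * (\<theta> i)\<^sup>2"
    and small: "\<And>i. i \<in> I \<Longrightarrow> \<bar>\<theta> i\<bar> < \<eta> \<Longrightarrow> (\<integral>x. (h i x - \<theta> i * \<psi> x)\<^sup>2 \<partial>P) \<le> \<epsilon> * (\<theta> i)\<^sup>2"
    and pos: "\<eta> > 0" "\<epsilon> \<ge> 0" "C \<ge> 0"
  shows "(\<integral>x. (\<Sum>i\<in>I. h i x)\<^sup>2 \<partial>P) / card I \<le> 2 * \<epsilon> * \<delta>\<^sup>2 + 2 * C * \<delta> ^ 4 / (\<eta>\<^sup>2 * card I)"
proof -
  define Z where "Z i x = h i x - \<theta> i * \<psi> x" for i x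
  define S where "S = {i\<in>I. \<bar>\<theta> i\<bar> < \<eta>}"
  define L where "L = {i\<in>I. \<bar>\<theta> i\<bar> \<ge> \<eta>}"
  define n where "n = real (card I)"
  have n: "n > 0" using I by (simp add: n_def card_gt_0_iff)
  have SL: "I = S \<union> L" "S \<inter> L = {}" "finite S" "finite L"
    using I by (auto simp: S_def L_def)
  have int_Z: "integrable P (\<lambda>x. (Z i x)\<^sup>2)" if "i \<in> I" for i
    using int[OF that] by (simp add: Z_def)
  have sum_h: "(\<Sum>i\<in>I. h i x) = (\<Sum>i\<in>S. Z i x) + (\<Sum>i\<in>L. Z i x)" for x
  proof -
    have "(\<Sum>i\<in>I. h i x) = (\<Sum>i\<in>I. Z i x) + (\<Sum>i\<in>I. \<theta> i) * \<psi> x"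
      by (simp add: Z_def sum_subtractf sum_distrib_right)
    also have "\<dots> = (\<Sum>i\<in>S. Z i x) + (\<Sum>i\<in>L. Z i x)"
      unfolding centred using SL by (simp add: sum.union_disjoint)
    finally show ?thesis .
  qed
  have card_L: "card L * \<eta>\<^sup>2 \<le> \<delta>\<^sup>2"
  proof -
    have "card L * \<eta>\<^sup>2 = (\<Sum>i\<in>L. \<eta>\<^sup>2)" by simp
    also have "\<dots> \<le> (\<Sum>i\<in>L. (\<theta> i)\<^sup>2)"
      using pos by (intro sum_mono) (auto simp: L_def abs_le_square_iff[symmetric])
    also have "\<dots> \<le> (\<Sum>i\<in>I. (\<theta> i)\<^sup>2)" using I SL by (intro sum_mono2) auto
    finally show ?thesis using size by simp
  qed
  have card_S: "card S \<le> n" unfolding n_def using I by (auto simp: S_def intro: card_mono)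
  have pointwise: "(\<Sum>i\<in>I. h i x)\<^sup>2 \<le> 2 * n * (\<Sum>i\<in>S. (Z i x)\<^sup>2) + 2 * card L * (\<Sum>i\<in>L. (Z i x)\<^sup>2)" for x
  proof -
    have "(\<Sum>i\<in>I. h i x)\<^sup>2 \<le> 2 * (\<Sum>i\<in>S. Z i x)\<^sup>2 + 2 * (\<Sum>i\<in>L. Z i x)\<^sup>2"
      unfolding sum_h using sum_squares_bound[of "\<Sum>i\<in>S. Z i x" "\<Sum>i\<in>L. Z i x"]
      by (simp add: power2_sum)
    also have "(\<Sum>i\<in>S. Z i x)\<^sup>2 \<le> (\<Sum>i\<in>S. (Z i x)\<^sup>2) * card S" by (rule sum_squared_le_sum_of_squares)
    also have "\<dots> \<le> (\<Sum>i\<in>S. (Z i x)\<^sup>2) * n" using card_S by (intro mult_left_mono) (auto intro: sum_nonneg)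
    also have "(\<Sum>i\<in>L. Z i x)\<^sup>2 \<le> (\<Sum>i\<in>L. (Z i x)\<^sup>2) * card L" by (rule sum_squared_le_sum_of_squares)
    finally show ?thesis by (simp add: mult_ac)
  qed
  have "(\<integral>x. (\<Sum>i\<in>I. h i x)\<^sup>2 \<partial>P) \<le>
      (\<integral>x. 2 * n * (\<Sum>i\<in>S. (Z i x)\<^sup>2) + 2 * card L * (\<Sum>i\<in>L. (Z i x)\<^sup>2) \<partial>P)"
  proof (rule integral_mono[OF _ _ pointwise])
    show int_bound: "integrable P (\<lambda>x. 2 * n * (\<Sum>i\<in>S. (Z i x)\<^sup>2) + 2 * card L * (\<Sum>i\<in>L. (Z i x)\<^sup>2))"
      using int_Z SL by (intro Bochner_Integration.integrable_add integrable_mult_right integrable_sum) auto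
    show "integrable P (\<lambda>x. (\<Sum>i\<in>I. h i x)\<^sup>2)"
    proof (rule Bochner_Integration.integrable_bound[OF int_bound])
      show "AE x in P. norm ((\<Sum>i\<in>I. h i x)\<^sup>2)
          \<le> norm (2 * n * (\<Sum>i\<in>S. (Z i x)\<^sup>2) + 2 * card L * (\<Sum>i\<in>L. (Z i x)\<^sup>2))"
        unfolding real_norm_def abs_power2 by (intro AE_I2 order_trans[OF pointwise abs_ge_self])
    qed (use meas in measurable)
  qed
  also have "\<dots> = 2 * n * (\<Sum>i\<in>S. \<integral>x. (Z i x)\<^sup>2 \<partial>P) + 2 * card L * (\<Sum>i\<in>L. \<integral>x. (Z i x)\<^sup>2 \<partial>P)"
    using int_Z SL by (simp add: integrable_sum)
  also have "\<dots> \<le> 2 * n * (\<epsilon> * \<delta>\<^sup>2) + 2 * card L * (C * \<delta>\<^sup>2)"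
  proof (intro add_mono mult_left_mono)
    have "(\<Sum>i\<in>S. \<integral>x. (Z i x)\<^sup>2 \<partial>P) \<le> (\<Sum>i\<in>S. \<epsilon> * (\<theta> i)\<^sup>2)"
      unfolding Z_def using small by (intro sum_mono) (auto simp: S_def)
    also have "\<dots> \<le> (\<Sum>i\<in>I. \<epsilon> * (\<theta> i)\<^sup>2)" using pos I SL by (intro sum_mono2) auto
    also have "\<dots> \<le> \<epsilon> * \<delta>\<^sup>2" using size pos by (simp add: mult_left_mono flip: sum_distrib_left)
    finally show "(\<Sum>i\<in>S. \<integral>x. (Z i x)\<^sup>2 \<partial>P) \<le> \<epsilon> * \<delta>\<^sup>2" .
    have "(\<Sum>i\<in>L. \<integral>x. (Z i x)\<^sup>2 \<partial>P) \<le> (\<Sum>i\<in>L. C * (\<theta> i)\<^sup>2)"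
      unfolding Z_def using le by (intro sum_mono) (auto simp: L_def)
    also have "\<dots> \<le> (\<Sum>i\<in>I. C * (\<theta> i)\<^sup>2)" using pos I SL by (intro sum_mono2) auto
    also have "\<dots> \<le> C * \<delta>\<^sup>2" using size pos by (simp add: mult_left_mono flip: sum_distrib_left)
    finally show "(\<Sum>i\<in>L. \<integral>x. (Z i x)\<^sup>2 \<partial>P) \<le> C * \<delta>\<^sup>2" .
  qed (use n in auto)
  also have "\<dots> \<le> 2 * n * (\<epsilon> * \<delta>\<^sup>2) + 2 * (\<delta>\<^sup>2 / \<eta>\<^sup>2) * (C * \<delta>\<^sup>2)"
    using card_L pos by (intro add_left_mono mult_right_mono) (auto simp: field_simps)
  also have "\<dots> = n * (2 * \<epsilon> * \<delta>\<^sup>2 + 2 * C * \<delta> ^ 4 / (\<eta>\<^sup>2 * n))"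
    using n pos by (simp add: field_simps power2_eq_square power4_eq_xxxx)
  finally show ?thesis
    using n unfolding n_def[symmetric] by (simp add: pos_divide_le_eq mult.commute)
qed

section \<open>Two limit theorems and truncated exponentials\<close>

text \<open>
  Pratt's extension of dominated convergence: the dominating functions may vary if their integrals
  converge to the integral of their limit \<open>G\<close>. The part of \<open>f\<^sub>k\<close> below \<open>G\<close> is handled by ordinary dominated
  convergence; the part above is at most the positive part of \<open>g\<^sub>k - G\<close>, whose integral tends to \<open>0\<close>
  since that of the negative part does.
\<close>

lemma tendsto_integral_0_of_dominating_sequence:
  fixes f g :: "nat \<Rightarrow> 'a \<Rightarrow> real" and G :: "'a \<Rightarrow> real"
  assumes f[measurable]: "\<And>k. f k \<in> borel_measurable M"
    and g: "\<And>k. integrable M (g k)" and G: "integrable M G"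
    and fg: "\<And>k x. x \<in> space M \<Longrightarrow> 0 \<le> f k x" "\<And>k x. x \<in> space M \<Longrightarrow> f k x \<le> g k x"
    and f_lim: "\<And>x. x \<in> space M \<Longrightarrow> (\<lambda>k. f k x) \<longlonglongrightarrow> 0"
    and g_lim: "\<And>x. x \<in> space M \<Longrightarrow> (\<lambda>k. g k x) \<longlonglongrightarrow> G x"
    and int_lim: "(\<lambda>k. \<integral>x. g k x \<partial>M) \<longlonglongrightarrow> (\<integral>x. G x \<partial>M)"
  shows "(\<lambda>k. \<integral>x. f k x \<partial>M) \<longlonglongrightarrow> 0"
proof -
  have [measurable]: "\<And>k. g k \<in> borel_measurable M" "G \<in> borel_measurable M"
    using g G by auto
  have G0: "0 \<le> G x" if "x \<in> space M" for x
    by (rule LIMSEQ_le_const[OF g_lim[OF that]]) (use fg[OF that] order_trans in blast)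
  have lim1: "(\<lambda>k. \<integral>x. min (f k x) (G x) \<partial>M) \<longlonglongrightarrow> (\<integral>x. 0 \<partial>M)"
  proof (rule integral_dominated_convergence[where w=G])
    show "AE x in M. (\<lambda>k. min (f k x) (G x)) \<longlonglongrightarrow> 0"
    proof (rule AE_I2)
      fix x assume x: "x \<in> space M"
      have "(\<lambda>k. min (f k x) (G x)) \<longlonglongrightarrow> min 0 (G x)"
        by (intro tendsto_min f_lim x tendsto_const)
      then show "(\<lambda>k. min (f k x) (G x)) \<longlonglongrightarrow> 0" using G0[OF x] by simp
    qed
    show "AE x in M. norm (min (f k x) (G x)) \<le> G x" for k
      using fg G0 by (intro AE_I2) auto
  qed (use G in auto)
  have lim2: "(\<lambda>k. \<integral>x. max (G x - g k x) 0 \<partial>M) \<longlonglongrightarrow> (\<integral>x. 0 \<partial>M)"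
  proof (rule integral_dominated_convergence[where w=G])
    show "AE x in M. (\<lambda>k. max (G x - g k x) 0) \<longlonglongrightarrow> 0"
    proof (rule AE_I2)
      fix x assume x: "x \<in> space M"
      have "(\<lambda>k. max (G x - g k x) 0) \<longlonglongrightarrow> max (G x - G x) 0"
        by (intro tendsto_max tendsto_diff g_lim x tendsto_const)
      then show "(\<lambda>k. max (G x - g k x) 0) \<longlonglongrightarrow> 0" by simp
    qed
    show "AE x in M. norm (max (G x - g k x) 0) \<le> G x" for k
    proof (rule AE_I2)
      fix x assume x: "x \<in> space M"
      show "norm (max (G x - g k x) 0) \<le> G x"
        using G0[OF x] fg(1)[OF x, of k] fg(2)[OF x, of k] by auto
    qed
  qed (use G in auto)
  have int_max: "integrable M (\<lambda>x. max (G x - g k x) 0)" for k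
    using g[of k] G by (intro integrable_max) auto
  have int_min: "integrable M (\<lambda>x. min (f k x) (G x))" for k
    by (rule Bochner_Integration.integrable_bound[OF G]) (use fg G0 in \<open>auto intro!: AE_I2\<close>)
  have bound: "(\<integral>x. f k x \<partial>M) \<le> (\<integral>x. min (f k x) (G x) \<partial>M) +
      ((\<integral>x. g k x \<partial>M) - (\<integral>x. G x \<partial>M) + (\<integral>x. max (G x - g k x) 0 \<partial>M))" for k
  proof -
    have "(\<integral>x. f k x \<partial>M) \<le> (\<integral>x. min (f k x) (G x) + (g k x - G x + max (G x - g k x) 0) \<partial>M)"
    proof (rule integral_mono)
      show "integrable M (f k)"
        by (rule Bochner_Integration.integrable_bound[OF g[of k]]) (use fg in \<open>auto intro!: AE_I2 order_trans[OF _ abs_ge_self]\<close>)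
      show "integrable M (\<lambda>x. min (f k x) (G x) + (g k x - G x + max (G x - g k x) 0))"
        using int_min int_max g G by simp
      show "f k x \<le> min (f k x) (G x) + (g k x - G x + max (G x - g k x) 0)" if "x \<in> space M" for x
        using fg(2)[OF that, of k] by auto
    qed
    also have "\<dots> = (\<integral>x. min (f k x) (G x) \<partial>M) +
      ((\<integral>x. g k x \<partial>M) - (\<integral>x. G x \<partial>M) + (\<integral>x. max (G x - g k x) 0 \<partial>M))"
      using int_min int_max g G by simp
    finally show ?thesis .
  qed
  have "(\<lambda>k. (\<integral>x. min (f k x) (G x) \<partial>M) +
      ((\<integral>x. g k x \<partial>M) - (\<integral>x. G x \<partial>M) + (\<integral>x. max (G x - g k x) 0 \<partial>M)))
      \<longlonglongrightarrow> (\<integral>x. 0 \<partial>M) + ((\<integral>x. G x \<partial>M) - (\<integral>x. G x \<partial>M) + (\<integral>x. 0 \<partial>M))"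
    by (intro tendsto_add tendsto_diff lim1 lim2 int_lim tendsto_const)
  then have upper: "(\<lambda>k. (\<integral>x. min (f k x) (G x) \<partial>M) +
      ((\<integral>x. g k x \<partial>M) - (\<integral>x. G x \<partial>M) + (\<integral>x. max (G x - g k x) 0 \<partial>M))) \<longlonglongrightarrow> 0"
    by simp
  show ?thesis
  proof (rule tendsto_sandwich[OF _ _ tendsto_const upper])
    show "\<forall>\<^sub>F k in sequentially. 0 \<le> (\<integral>x. f k x \<partial>M)"
      by (intro always_eventually allI Bochner_Integration.integral_nonneg fg)
  qed (use bound in simp)
qed

text \<open>
  A continuously differentiable function is strictly differentiable: both end points may move.
\<close>

lemma divided_difference_tendsto_deriv:
  fixes \<psi> \<psi>' :: "real \<Rightarrow> real"
  assumes \<Theta>: "open \<Theta>" "t \<in> \<Theta>"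
    and deriv: "\<And>s. s \<in> \<Theta> \<Longrightarrow> (\<psi> has_real_derivative \<psi>' s) (at s)"
    and cont: "isCont \<psi>' t"
    and uv: "u \<longlonglongrightarrow> t" "v \<longlonglongrightarrow> t" "\<And>k. u k \<noteq> v k"
  shows "(\<lambda>k. (\<psi> (u k) - \<psi> (v k)) / (u k - v k)) \<longlonglongrightarrow> \<psi>' t"
proof (rule tendstoI)
  fix e :: real assume e: "e > 0"
  have "\<forall>\<^sub>F s in nhds t. s \<in> \<Theta> \<and> dist (\<psi>' s) (\<psi>' t) < e"
    using \<Theta> cont e
    by (intro eventually_conj eventually_nhds_in_open)
      (auto simp: isCont_def tendsto_at_iff_tendsto_nhds dest: tendstoD)
  then obtain r where r: "r > 0" "\<And>s. dist s t < r \<Longrightarrow> s \<in> \<Theta> \<and> dist (\<psi>' s) (\<psi>' t) < e"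
    unfolding eventually_nhds_metric by blast
  have "\<forall>\<^sub>F k in sequentially. dist (u k) t < r \<and> dist (v k) t < r"
    using uv r by (intro eventually_conj tendstoD)
  then show "\<forall>\<^sub>F k in sequentially. dist ((\<psi> (u k) - \<psi> (v k)) / (u k - v k)) (\<psi>' t) < e"
  proof eventually_elim
    case (elim k)
    define a b where "a = min (u k) (v k)" and "b = max (u k) (v k)"
    have ab: "a < b" using uv(3)[of k] by (auto simp: a_def b_def)
    have near: "dist s t < r" if "a \<le> s" "s \<le> b" for s
      using elim that by (auto simp: a_def b_def dist_real_def abs_real_def split: if_splits)
    obtain \<xi> where \<xi>: "a < \<xi>" "\<xi> < b" "\<psi> b - \<psi> a = (b - a) * \<psi>' \<xi>"
      using MVT2[OF ab, of \<psi> \<psi>'] deriv r(2) near by blast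
    have "(\<psi> (u k) - \<psi> (v k)) / (u k - v k) = (\<psi> b - \<psi> a) / (b - a)"
      using minus_divide_divide[of "\<psi> (u k) - \<psi> (v k)" "u k - v k"]
      by (simp add: a_def b_def min_def max_def)
    also have "\<dots> = \<psi>' \<xi>" using \<xi> ab by simp
    finally show ?case using r(2)[OF near[of \<xi>]] \<xi> by simp
  qed
qed

text \<open>
  The map \<open>y \<mapsto> min (exp y) K\<close> takes the value \<open>1\<close> at \<open>0\<close> and is Lipschitz with constant \<open>K\<close>.
\<close>

lemma abs_min_exp_minus_one_le:
  fixes y K :: real
  assumes "K \<ge> 1"
  shows "\<bar>min (exp y) K - 1\<bar> \<le> K * \<bar>y\<bar>"
proof (cases "y \<ge> 0")
  case True
  have "min (exp y) K * exp (- y) \<le> 1"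
    using mult_right_mono[of "min (exp y) K" "exp y" "exp (- y)"] by (simp add: exp_minus_inverse)
  moreover have "min (exp y) K * (1 - y) \<le> min (exp y) K * exp (- y)"
    using exp_ge_add_one_self[of "- y"] assms by (intro mult_left_mono) auto
  ultimately have "min (exp y) K - 1 \<le> min (exp y) K * y" by (simp add: algebra_simps)
  also have "\<dots> \<le> K * y" using True by (intro mult_right_mono) auto
  finally have "min (exp y) K - 1 \<le> K * y" .
  moreover have "1 \<le> min (exp y) K" using True assms by simp
  ultimately show ?thesis using True by simp
next
  case False
  then have "exp y \<le> 1" by simp
  moreover have "min (exp y) K = exp y" using \<open>exp y \<le> 1\<close> assms by (intro min_absorb1) linarith
  ultimately have "\<bar>min (exp y) K - 1\<bar> = 1 - exp y" by linarith
  also have "\<dots> \<le> \<bar>y\<bar>" using exp_ge_add_one_self[of y] False by linarith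
  also have "\<dots> \<le> K * \<bar>y\<bar>" using assms mult_right_mono[of 1 K "\<bar>y\<bar>"] by simp
  finally show ?thesis .
qed

text \<open>
  Chebyshev's inequality in pointwise form: truncation acts only where \<open>y > ln K\<close>.
\<close>

lemma exp_minus_min_le:
  fixes y K :: real
  assumes "K > 1"
  shows "exp y - min (exp y) K \<le> exp y * (y\<^sup>2 / (ln K)\<^sup>2)"
proof (cases "exp y \<le> K")
  case False
  have "ln K > 0" using assms by simp
  have "ln K \<le> y" using False assms by (metis less_trans linear ln_exp ln_mono not_le zero_less_one)
  then have "(ln K)\<^sup>2 \<le> y\<^sup>2" using \<open>ln K > 0\<close> by (intro power_mono) auto
  then have "1 \<le> y\<^sup>2 / (ln K)\<^sup>2" using \<open>ln K > 0\<close> by simp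
  then have "exp y * 1 \<le> exp y * (y\<^sup>2 / (ln K)\<^sup>2)" by (intro mult_left_mono) auto
  then show ?thesis using False assms by simp
qed simp

section \<open>Quadratic mean differentiability of truncated likelihood ratios\<close>

definition second_moment :: "real measure \<Rightarrow> real" where
  "second_moment F = (\<integral>x. x\<^sup>2 \<partial>F)"

lemma continuous_map_second_moment:
  "continuous_map finite_variance_topology euclideanreal second_moment"
proof -
  have "bounded (range (\<lambda>x::real. x\<^sup>2 / (1 + x\<^sup>2)))"
  proof (rule boundedI)
    fix y :: real assume "y \<in> range (\<lambda>x. x\<^sup>2 / (1 + x\<^sup>2))"
    then obtain x where y: "y = x\<^sup>2 / (1 + x\<^sup>2)" by blast
    have "0 < 1 + x\<^sup>2" by (simp add: add_pos_nonneg)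
    then show "norm y \<le> 1" by (simp add: y)
  qed
  then have growth: "(\<lambda>x. x\<^sup>2) \<in> quadratic_growth"
    by (auto simp: quadratic_growth_def intro!: continuous_intros)
  show ?thesis
    unfolding continuous_map_def
  proof (intro conjI allI impI)
    fix U :: "real set" assume "openin euclideanreal U"
    then show "openin finite_variance_topology {F \<in> topspace finite_variance_topology. second_moment F \<in> U}"
      unfolding topspace_finite_variance_topology unfolding finite_variance_topology_def second_moment_def
      using growth by (intro topology_generated_by_Basis) auto
  qed auto
qed

text \<open>
  The regularity behind the expansion of likelihood ratios. A continuous score gives pointwise
  convergence of difference quotients with moving end points; continuity of the quotient laws gives
  convergence of their second moments.
\<close>

locale score_family =
  fixes \<mu> :: "'a measure" and \<Theta> \<Theta>\<^sub>0 :: "real set" and \<phi> \<phi>\<^sub>1 :: "'a \<Rightarrow> real \<Rightarrow> real"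
  assumes open_\<Theta>: "open \<Theta>"
    and measurable_\<phi>: "m \<in> \<Theta> \<Longrightarrow> (\<lambda>x. \<phi> x m) \<in> borel_measurable \<mu>"
    and measurable_\<phi>1: "m \<in> \<Theta> \<Longrightarrow> (\<lambda>x. \<phi>\<^sub>1 x m) \<in> borel_measurable \<mu>"
    and prob_space_obs_law: "m \<in> \<Theta> \<Longrightarrow> prob_space (obs_law \<mu> \<phi> m)"
    and deriv_\<phi>: "x \<in> space \<mu> \<Longrightarrow> m \<in> \<Theta> \<Longrightarrow> (\<phi> x has_real_derivative \<phi>\<^sub>1 x m) (at m)"
    and cont_\<phi>1: "x \<in> space \<mu> \<Longrightarrow> m \<in> \<Theta> \<Longrightarrow> isCont (\<phi>\<^sub>1 x) m"
    and compact_\<Theta>0: "compact \<Theta>\<^sub>0" and \<Theta>0_subset: "\<Theta>\<^sub>0 \<subseteq> \<Theta>"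
    and continuous_quotient_law:
      "continuous_map (top_of_set (\<Theta>\<^sub>0 \<times> \<Theta>\<^sub>0)) finite_variance_topology
         (\<lambda>(m, m'). quotient_law \<mu> \<phi> \<phi>\<^sub>1 m m')"
begin

definition score_quotient :: "real \<Rightarrow> real \<Rightarrow> 'a \<Rightarrow> real" where
  "score_quotient m m' x = (if m = m' then \<phi>\<^sub>1 x m' else (\<phi> x m - \<phi> x m') / (m - m'))"

definition trunc_ratio :: "real \<Rightarrow> real \<Rightarrow> real \<Rightarrow> 'a \<Rightarrow> real" where
  "trunc_ratio K m m' x = min (exp (\<phi> x m - \<phi> x m')) K"

lemma in_\<Theta>: "m \<in> \<Theta>\<^sub>0 \<Longrightarrow> m \<in> \<Theta>"
  using \<Theta>0_subset by blast

lemma space_obs_law [simp]: "space (obs_law \<mu> \<phi> m) = space \<mu>"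
  and sets_obs_law [measurable_cong, simp]: "sets (obs_law \<mu> \<phi> m) = sets \<mu>"
  by (simp_all add: obs_law_def)

lemma measurable_obs_law [simp]: "borel_measurable (obs_law \<mu> \<phi> m) = borel_measurable \<mu>"
  by (intro measurable_cong_sets) simp_all

lemma integral_obs_law:
  fixes f :: "'a \<Rightarrow> real"
  assumes "m \<in> \<Theta>" "f \<in> borel_measurable \<mu>"
  shows "(\<integral>x. f x \<partial>obs_law \<mu> \<phi> m) = (\<integral>x. exp (\<phi> x m) * f x \<partial>\<mu>)"
    and "integrable (obs_law \<mu> \<phi> m) f \<longleftrightarrow> integrable \<mu> (\<lambda>x. exp (\<phi> x m) * f x)"
  using assms measurable_\<phi>[OF assms(1)]
  by (simp_all add: obs_law_def integral_density integrable_density)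

text \<open>
  All laws of the family have a positive density with respect to \<open>\<mu>\<close>, so each is a base measure for
  the others.
\<close>

lemma obs_law_eq_density:
  assumes "m \<in> \<Theta>" "m' \<in> \<Theta>"
  shows "obs_law \<mu> \<phi> m = density (obs_law \<mu> \<phi> m') (\<lambda>x. exp (\<phi> x m - \<phi> x m'))"
proof -
  have [measurable]: "(\<lambda>x. \<phi> x m) \<in> borel_measurable \<mu>" "(\<lambda>x. \<phi> x m') \<in> borel_measurable \<mu>"
    using assms measurable_\<phi> by auto
  show ?thesis
    unfolding obs_law_def
    by (subst density_density_eq) (auto simp: ennreal_mult[symmetric] exp_diff)
qed

lemma measurable_quotient: "m \<in> \<Theta> \<Longrightarrow> m' \<in> \<Theta> \<Longrightarrow> score_quotient m m' \<in> borel_measurable \<mu>"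
  using measurable_\<phi> measurable_\<phi>1 by (cases "m = m'") (auto simp: score_quotient_def[abs_def])

lemma measurable_trunc_ratio:
  assumes "m \<in> \<Theta>" "m' \<in> \<Theta>"
  shows "trunc_ratio K m m' \<in> borel_measurable \<mu>"
proof -
  have [measurable]: "(\<lambda>x. \<phi> x m) \<in> borel_measurable \<mu>" "(\<lambda>x. \<phi> x m') \<in> borel_measurable \<mu>"
    using assms measurable_\<phi> by auto
  show ?thesis unfolding trunc_ratio_def[abs_def] by measurable
qed

text \<open>
  Membership of the laws in \<open>finite_variance_laws\<close> is contained in the continuity of the map into
  that space.
\<close>

lemma quotient_second_moment:
  assumes "m \<in> \<Theta>\<^sub>0" "m' \<in> \<Theta>\<^sub>0"
  shows "integrable (obs_law \<mu> \<phi> m') (\<lambda>x. (score_quotient m m' x)\<^sup>2)"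
    and "(\<integral>x. (score_quotient m m' x)\<^sup>2 \<partial>obs_law \<mu> \<phi> m') = second_moment (quotient_law \<mu> \<phi> \<phi>\<^sub>1 m m')"
proof -
  have law: "quotient_law \<mu> \<phi> \<phi>\<^sub>1 m m' = distr (obs_law \<mu> \<phi> m') borel (score_quotient m m')"
    by (auto simp: quotient_law_def score_quotient_def[abs_def])
  have [measurable]: "score_quotient m m' \<in> measurable (obs_law \<mu> \<phi> m') borel"
    using measurable_quotient assms in_\<Theta> by simp
  have "quotient_law \<mu> \<phi> \<phi>\<^sub>1 m m' \<in> finite_variance_laws"
    using continuous_map_image_subset_topspace[OF continuous_quotient_law] assms
    by (auto simp: topspace_finite_variance_topology)
  then have "integrable (distr (obs_law \<mu> \<phi> m') borel (score_quotient m m')) (\<lambda>x. x\<^sup>2)"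
    by (simp add: finite_variance_laws_def law)
  then show "integrable (obs_law \<mu> \<phi> m') (\<lambda>x. (score_quotient m m' x)\<^sup>2)"
    by (subst (asm) integrable_distr_eq) auto
  show "(\<integral>x. (score_quotient m m' x)\<^sup>2 \<partial>obs_law \<mu> \<phi> m') = second_moment (quotient_law \<mu> \<phi> \<phi>\<^sub>1 m m')"
    unfolding second_moment_def law by (subst integral_distr) auto
qed

lemma continuous_second_moment_quotient:
  "continuous_on (\<Theta>\<^sub>0 \<times> \<Theta>\<^sub>0) (\<lambda>p. second_moment (quotient_law \<mu> \<phi> \<phi>\<^sub>1 (fst p) (snd p)))"
  using continuous_map_compose[OF continuous_quotient_law continuous_map_second_moment]
  by (simp add: continuous_map_iff_continuous comp_def case_prod_beta)

lemma second_moment_quotient_tendsto: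
  assumes "u \<longlonglongrightarrow> m" "v \<longlonglongrightarrow> m" "m \<in> \<Theta>\<^sub>0" "\<And>k. u k \<in> \<Theta>\<^sub>0" "\<And>k. v k \<in> \<Theta>\<^sub>0"
  shows "(\<lambda>k. second_moment (quotient_law \<mu> \<phi> \<phi>\<^sub>1 (u k) (v k)))
    \<longlonglongrightarrow> second_moment (quotient_law \<mu> \<phi> \<phi>\<^sub>1 m m)"
  using continuous_on_tendsto_compose[OF continuous_second_moment_quotient tendsto_Pair[OF assms(1,2)]]
    assms by simp

lemma second_moment_quotient_bounded:
  obtains C where "C \<ge> 0"
    "\<And>m m'. m \<in> \<Theta>\<^sub>0 \<Longrightarrow> m' \<in> \<Theta>\<^sub>0 \<Longrightarrow> (\<integral>x. (score_quotient m m' x)\<^sup>2 \<partial>obs_law \<mu> \<phi> m') \<le> C"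
proof -
  have "compact ((\<lambda>p. second_moment (quotient_law \<mu> \<phi> \<phi>\<^sub>1 (fst p) (snd p))) ` (\<Theta>\<^sub>0 \<times> \<Theta>\<^sub>0))"
    by (intro compact_continuous_image continuous_second_moment_quotient compact_Times compact_\<Theta>0)
  from compact_imp_bounded[OF this]
  obtain C where "\<forall>y\<in>(\<lambda>p. second_moment (quotient_law \<mu> \<phi> \<phi>\<^sub>1 (fst p) (snd p))) ` (\<Theta>\<^sub>0 \<times> \<Theta>\<^sub>0). norm y \<le> C"
    unfolding bounded_iff by (elim exE)
  then have C: "norm (second_moment (quotient_law \<mu> \<phi> \<phi>\<^sub>1 (fst p) (snd p))) \<le> C"
    if "p \<in> \<Theta>\<^sub>0 \<times> \<Theta>\<^sub>0" for p
    using that by (rule bspec[OF _ imageI])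
  show ?thesis
  proof (rule that[of "max C 0"])
    fix m m' assume m: "m \<in> \<Theta>\<^sub>0" "m' \<in> \<Theta>\<^sub>0"
    then have "\<bar>second_moment (quotient_law \<mu> \<phi> \<phi>\<^sub>1 m m')\<bar> \<le> C"
      using C[of "(m, m')"] by simp
    then show "(\<integral>x. (score_quotient m m' x)\<^sup>2 \<partial>obs_law \<mu> \<phi> m') \<le> max C 0"
      unfolding quotient_second_moment(2)[OF m] by linarith
  qed simp
qed

lemma log_ratio_eq_quotient: "\<phi> x m - \<phi> x m' = (m - m') * score_quotient m m' x"
  by (simp add: score_quotient_def)

lemma trunc_ratio_minus_one_bound:
  assumes "K \<ge> 1"
  shows "(trunc_ratio K m m' x - 1)\<^sup>2 \<le> (m - m')\<^sup>2 * (K\<^sup>2 * (score_quotient m m' x)\<^sup>2)"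
proof -
  have "\<bar>trunc_ratio K m m' x - 1\<bar> \<le> K * \<bar>(m - m') * score_quotient m m' x\<bar>"
    unfolding trunc_ratio_def log_ratio_eq_quotient by (rule abs_min_exp_minus_one_le[OF assms])
  then have "\<bar>trunc_ratio K m m' x - 1\<bar>\<^sup>2 \<le> (K * \<bar>(m - m') * score_quotient m m' x\<bar>)\<^sup>2"
    by (intro power_mono) auto
  then show ?thesis by (simp add: power_mult_distrib mult_ac)
qed

lemma score_residual_bound:
  assumes "K \<ge> 1"
  shows "(trunc_ratio K m m' x - 1 - (m - m') * \<phi>\<^sub>1 x m')\<^sup>2
    \<le> (m - m')\<^sup>2 * (2 * K\<^sup>2 * (score_quotient m m' x)\<^sup>2 + 2 * (score_quotient m' m' x)\<^sup>2)"
proof -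
  have "(a - b)\<^sup>2 \<le> 2 * a\<^sup>2 + 2 * b\<^sup>2" for a b :: real
    using sum_squares_bound[of a "- b"] by (simp add: power2_diff)
  then have "(trunc_ratio K m m' x - 1 - (m - m') * \<phi>\<^sub>1 x m')\<^sup>2
      \<le> 2 * (trunc_ratio K m m' x - 1)\<^sup>2 + 2 * ((m - m') * \<phi>\<^sub>1 x m')\<^sup>2" .
  also have "\<dots> \<le> 2 * ((m - m')\<^sup>2 * (K\<^sup>2 * (score_quotient m m' x)\<^sup>2)) + 2 * ((m - m') * \<phi>\<^sub>1 x m')\<^sup>2"
    using trunc_ratio_minus_one_bound[OF assms, of m m' x] by simp
  also have "((m - m') * \<phi>\<^sub>1 x m')\<^sup>2 = (m - m')\<^sup>2 * (score_quotient m' m' x)\<^sup>2"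
    by (simp add: score_quotient_def power_mult_distrib)
  finally show ?thesis by (simp add: distrib_left mult_ac)
qed

lemma integrable_trunc_ratio_square:
  assumes K: "K \<ge> 1" and m: "m \<in> \<Theta>\<^sub>0" "m' \<in> \<Theta>\<^sub>0"
  shows "integrable (obs_law \<mu> \<phi> m') (\<lambda>x. (trunc_ratio K m m' x - 1)\<^sup>2)"
  and "integrable (obs_law \<mu> \<phi> m') (\<lambda>x. (trunc_ratio K m m' x - 1 - (m - m') * \<phi>\<^sub>1 x m')\<^sup>2)"
proof -
  have [measurable]: "trunc_ratio K m m' \<in> borel_measurable \<mu>" "(\<lambda>x. \<phi>\<^sub>1 x m') \<in> borel_measurable \<mu>"
    using m in_\<Theta> measurable_trunc_ratio measurable_\<phi>1 by auto
  have "integrable (obs_law \<mu> \<phi> m') (\<lambda>x. (m - m')\<^sup>2 * (K\<^sup>2 * (score_quotient m m' x)\<^sup>2))"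
    using quotient_second_moment(1)[OF m] by simp
  then show "integrable (obs_law \<mu> \<phi> m') (\<lambda>x. (trunc_ratio K m m' x - 1)\<^sup>2)"
    by (rule Bochner_Integration.integrable_bound)
      (use trunc_ratio_minus_one_bound[OF K] in \<open>auto intro!: AE_I2\<close>)
  have "integrable (obs_law \<mu> \<phi> m')
      (\<lambda>x. (m - m')\<^sup>2 * (2 * K\<^sup>2 * (score_quotient m m' x)\<^sup>2 + 2 * (score_quotient m' m' x)\<^sup>2))"
    using quotient_second_moment(1)[OF m] quotient_second_moment(1)[OF m(2) m(2)] by simp
  then show "integrable (obs_law \<mu> \<phi> m') (\<lambda>x. (trunc_ratio K m m' x - 1 - (m - m') * \<phi>\<^sub>1 x m')\<^sup>2)"
    by (rule Bochner_Integration.integrable_bound)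
      (use score_residual_bound[OF K] in \<open>auto intro!: AE_I2\<close>)
qed

lemma trunc_ratio_moments:
  assumes K: "K \<ge> 1" and m: "m \<in> \<Theta>\<^sub>0" "m' \<in> \<Theta>\<^sub>0"
    and C: "\<And>m m'. m \<in> \<Theta>\<^sub>0 \<Longrightarrow> m' \<in> \<Theta>\<^sub>0 \<Longrightarrow> (\<integral>x. (score_quotient m m' x)\<^sup>2 \<partial>obs_law \<mu> \<phi> m') \<le> C"
  shows "(\<integral>x. (trunc_ratio K m m' x - 1)\<^sup>2 \<partial>obs_law \<mu> \<phi> m') \<le> K\<^sup>2 * C * (m - m')\<^sup>2"
    and "(\<integral>x. (trunc_ratio K m m' x - 1 - (m - m') * \<phi>\<^sub>1 x m')\<^sup>2 \<partial>obs_law \<mu> \<phi> m')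
      \<le> (2 * K\<^sup>2 * C + 2 * C) * (m - m')\<^sup>2"
proof -
  let ?P = "obs_law \<mu> \<phi> m'"
  have "(\<integral>x. (trunc_ratio K m m' x - 1)\<^sup>2 \<partial>?P) \<le> (\<integral>x. (m - m')\<^sup>2 * (K\<^sup>2 * (score_quotient m m' x)\<^sup>2) \<partial>?P)"
    using quotient_second_moment(1)[OF m] integrable_trunc_ratio_square(1)[OF K m]
    by (intro integral_mono trunc_ratio_minus_one_bound K) auto
  also have "\<dots> = (m - m')\<^sup>2 * (K\<^sup>2 * (\<integral>x. (score_quotient m m' x)\<^sup>2 \<partial>?P))" by simp
  also have "\<dots> \<le> (m - m')\<^sup>2 * (K\<^sup>2 * C)" by (intro mult_left_mono C m) auto
  finally show "(\<integral>x. (trunc_ratio K m m' x - 1)\<^sup>2 \<partial>?P) \<le> K\<^sup>2 * C * (m - m')\<^sup>2"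
    by (simp add: mult_ac)
  have "(\<integral>x. (trunc_ratio K m m' x - 1 - (m - m') * \<phi>\<^sub>1 x m')\<^sup>2 \<partial>?P)
      \<le> (\<integral>x. (m - m')\<^sup>2 * (2 * K\<^sup>2 * (score_quotient m m' x)\<^sup>2 + 2 * (score_quotient m' m' x)\<^sup>2) \<partial>?P)"
    using quotient_second_moment(1)[OF m] quotient_second_moment(1)[OF m(2) m(2)]
      integrable_trunc_ratio_square(2)[OF K m]
    by (intro integral_mono score_residual_bound K) auto
  also have "\<dots> = (m - m')\<^sup>2 * (2 * K\<^sup>2 * (\<integral>x. (score_quotient m m' x)\<^sup>2 \<partial>?P) +
      2 * (\<integral>x. (score_quotient m' m' x)\<^sup>2 \<partial>?P))"
    using quotient_second_moment(1)[OF m] quotient_second_moment(1)[OF m(2) m(2)] by simp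
  also have "\<dots> \<le> (m - m')\<^sup>2 * (2 * K\<^sup>2 * C + 2 * C)"
    by (intro mult_left_mono add_mono C m) auto
  finally show "(\<integral>x. (trunc_ratio K m m' x - 1 - (m - m') * \<phi>\<^sub>1 x m')\<^sup>2 \<partial>?P)
      \<le> (2 * K\<^sup>2 * C + 2 * C) * (m - m')\<^sup>2"
    by (simp add: mult_ac)
qed

text \<open>
  The mass lost by truncation is bounded through the second moment of the log ratio under the law at
  \<open>m\<close>, not under the base law at \<open>m'\<close>; this is why the difference quotient enters with its arguments
  exchanged.
\<close>

lemma trunc_ratio_mean:
  assumes K: "K > 1" and m: "m \<in> \<Theta>\<^sub>0" "m' \<in> \<Theta>\<^sub>0"
    and C: "\<And>m m'. m \<in> \<Theta>\<^sub>0 \<Longrightarrow> m' \<in> \<Theta>\<^sub>0 \<Longrightarrow> (\<integral>x. (score_quotient m m' x)\<^sup>2 \<partial>obs_law \<mu> \<phi> m') \<le> C"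
  shows "(\<integral>x. trunc_ratio K m m' x \<partial>obs_law \<mu> \<phi> m') \<le> 1"
    and "1 - (\<integral>x. trunc_ratio K m m' x \<partial>obs_law \<mu> \<phi> m') \<le> C / (ln K)\<^sup>2 * (m - m')\<^sup>2"
proof -
  let ?P = "obs_law \<mu> \<phi> m'"
  define r where "r x = exp (\<phi> x m - \<phi> x m')" for x
  have \<Theta>: "m \<in> \<Theta>" "m' \<in> \<Theta>" using m in_\<Theta> by auto
  have meas[measurable]: "(\<lambda>x. \<phi> x m) \<in> borel_measurable \<mu>" "(\<lambda>x. \<phi> x m') \<in> borel_measurable \<mu>"
    "trunc_ratio K m m' \<in> borel_measurable \<mu>" "score_quotient m' m \<in> borel_measurable \<mu>"
    using \<Theta> measurable_\<phi> measurable_trunc_ratio measurable_quotient by auto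
  have [measurable]: "r \<in> borel_measurable \<mu>" unfolding r_def by measurable
  have change: "(\<integral>x. f x \<partial>obs_law \<mu> \<phi> m) = (\<integral>x. r x * f x \<partial>?P)"
    "integrable (obs_law \<mu> \<phi> m) f \<longleftrightarrow> integrable ?P (\<lambda>x. r x * f x)"
    if "f \<in> borel_measurable \<mu>" for f :: "'a \<Rightarrow> real"
    unfolding obs_law_eq_density[OF \<Theta>] using that
    by (simp_all add: integral_density integrable_density r_def)
  interpret P: prob_space ?P using \<Theta> by (intro prob_space_obs_law)
  interpret Q: prob_space "obs_law \<mu> \<phi> m" using \<Theta> by (intro prob_space_obs_law)
  have int_r: "integrable ?P r" "(\<integral>x. r x \<partial>?P) = 1"
    using change[of "\<lambda>_. 1"] by (simp_all add: Q.prob_space[simplified])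
  have le_r: "trunc_ratio K m m' x \<le> r x" "0 \<le> trunc_ratio K m m' x" for x
    using K by (auto simp: trunc_ratio_def r_def)
  have int_g: "integrable ?P (trunc_ratio K m m')"
    by (rule Bochner_Integration.integrable_bound[OF int_r(1)])
      (use le_r in \<open>auto intro!: AE_I2 order_trans[OF _ abs_ge_self]\<close>)
  show "(\<integral>x. trunc_ratio K m m' x \<partial>?P) \<le> 1"
    using integral_mono[OF int_g int_r(1) le_r(1)] int_r(2) by simp
  have sq: "(\<phi> x m - \<phi> x m')\<^sup>2 = (m - m')\<^sup>2 * (score_quotient m' m x)\<^sup>2" for x
    using log_ratio_eq_quotient[of x m' m]
    by (metis power2_commute power_mult_distrib)
  have int_q: "integrable ?P (\<lambda>x. r x * (score_quotient m' m x)\<^sup>2)"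
    using quotient_second_moment(1)[OF m(2,1)] by (subst (asm) change(2)) auto
  have "1 - (\<integral>x. trunc_ratio K m m' x \<partial>?P) = (\<integral>x. r x - trunc_ratio K m m' x \<partial>?P)"
    using int_r int_g by simp
  also have "\<dots> \<le> (\<integral>x. (m - m')\<^sup>2 / (ln K)\<^sup>2 * (r x * (score_quotient m' m x)\<^sup>2) \<partial>?P)"
  proof (intro integral_mono)
    show "r x - trunc_ratio K m m' x \<le> (m - m')\<^sup>2 / (ln K)\<^sup>2 * (r x * (score_quotient m' m x)\<^sup>2)" for x
      using exp_minus_min_le[OF K, of "\<phi> x m - \<phi> x m'"] unfolding sq
      by (simp add: r_def trunc_ratio_def mult_ac)
  qed (use int_r int_g int_q in auto)
  also have "\<dots> = (m - m')\<^sup>2 / (ln K)\<^sup>2 * (\<integral>x. (score_quotient m' m x)\<^sup>2 \<partial>obs_law \<mu> \<phi> m)"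
    by (subst change(1)) auto
  also have "\<dots> \<le> (m - m')\<^sup>2 / (ln K)\<^sup>2 * C"
    by (intro mult_left_mono C m) auto
  finally show "1 - (\<integral>x. trunc_ratio K m m' x \<partial>?P) \<le> C / (ln K)\<^sup>2 * (m - m')\<^sup>2"
    by (simp add: mult_ac)
qed

text \<open>
  Written as integrals with respect to \<open>\<mu>\<close>, the squared residuals tend to \<open>0\<close> pointwise by strict
  differentiability of \<open>\<phi>\<close> and of \<open>exp \<circ> \<phi>\<close>. They are dominated by squared difference quotients, whose
  integrals converge because the second moment is continuous on the space of laws.
\<close>

lemma score_residual_tendsto_0:
  assumes K: "K > 1" and uv: "u \<longlonglongrightarrow> m" "v \<longlonglongrightarrow> m" "m \<in> \<Theta>\<^sub>0" "\<And>k. u k \<in> \<Theta>\<^sub>0" "\<And>k. v k \<in> \<Theta>\<^sub>0"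
    and neq: "\<And>k. u k \<noteq> v k"
  shows "(\<lambda>k. (\<integral>x. (trunc_ratio K (u k) (v k) x - 1 - (u k - v k) * \<phi>\<^sub>1 x (v k))\<^sup>2 \<partial>obs_law \<mu> \<phi> (v k))
    / (u k - v k)\<^sup>2) \<longlonglongrightarrow> 0"
proof -
  define R where "R k x = (trunc_ratio K (u k) (v k) x - 1 - (u k - v k) * \<phi>\<^sub>1 x (v k))\<^sup>2 / (u k - v k)\<^sup>2" for k x
  \<comment> \<open>The densities are absorbed into the integrands, since the laws vary with \<open>k\<close>.\<close>
  define f where "f k x = exp (\<phi> x (v k)) * R k x" for k x
  define g where "g k x = exp (\<phi> x (v k)) * (2 * K\<^sup>2 * (score_quotient (u k) (v k) x)\<^sup>2 + 2 * (score_quotient (v k) (v k) x)\<^sup>2)" for k x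
  define G where "G x = exp (\<phi> x m) * (2 * K\<^sup>2 * (score_quotient m m x)\<^sup>2 + 2 * (score_quotient m m x)\<^sup>2)" for x
  have \<Theta>: "u k \<in> \<Theta>" "v k \<in> \<Theta>" "m \<in> \<Theta>" for k using uv in_\<Theta> by auto
  have K1: "K \<ge> 1" using K by simp
  have [measurable]: "(\<lambda>x. \<phi> x (v k)) \<in> borel_measurable \<mu>" "(\<lambda>x. \<phi>\<^sub>1 x (v k)) \<in> borel_measurable \<mu>"
    "trunc_ratio K (u k) (v k) \<in> borel_measurable \<mu>" "score_quotient (u k) (v k) \<in> borel_measurable \<mu>"
    "score_quotient (v k) (v k) \<in> borel_measurable \<mu>" "score_quotient m m \<in> borel_measurable \<mu>" for k
    using \<Theta> measurable_\<phi> measurable_\<phi>1 measurable_trunc_ratio measurable_quotient by auto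
  have [measurable]: "R k \<in> borel_measurable \<mu>" for k
    unfolding R_def by measurable
  let ?sm = "\<lambda>a b. second_moment (quotient_law \<mu> \<phi> \<phi>\<^sub>1 a b)"
  have dom: "integrable \<mu> (\<lambda>x. exp (\<phi> x b) * (2 * K\<^sup>2 * (score_quotient a b x)\<^sup>2 + 2 * (score_quotient b b x)\<^sup>2))"
    "(\<integral>x. exp (\<phi> x b) * (2 * K\<^sup>2 * (score_quotient a b x)\<^sup>2 + 2 * (score_quotient b b x)\<^sup>2) \<partial>\<mu>) =
      2 * K\<^sup>2 * ?sm a b + 2 * ?sm b b" if ab: "a \<in> \<Theta>\<^sub>0" "b \<in> \<Theta>\<^sub>0" for a b
  proof -
    have [measurable]: "score_quotient a b \<in> borel_measurable \<mu>" "score_quotient b b \<in> borel_measurable \<mu>"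
      using ab in_\<Theta> measurable_quotient by auto
    have *: "(\<lambda>x. 2 * K\<^sup>2 * (score_quotient a b x)\<^sup>2 + 2 * (score_quotient b b x)\<^sup>2) \<in> borel_measurable \<mu>"
      by measurable
    note q = quotient_second_moment[OF ab] quotient_second_moment[OF ab(2) ab(2)]
    show "integrable \<mu> (\<lambda>x. exp (\<phi> x b) * (2 * K\<^sup>2 * (score_quotient a b x)\<^sup>2 + 2 * (score_quotient b b x)\<^sup>2))"
      unfolding integral_obs_law(2)[OF in_\<Theta>[OF ab(2)] *, symmetric] using q by simp
    show "(\<integral>x. exp (\<phi> x b) * (2 * K\<^sup>2 * (score_quotient a b x)\<^sup>2 + 2 * (score_quotient b b x)\<^sup>2) \<partial>\<mu>) =
      2 * K\<^sup>2 * ?sm a b + 2 * ?sm b b"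
      unfolding integral_obs_law(1)[OF in_\<Theta>[OF ab(2)] *, symmetric] using q by simp
  qed
  have "(\<lambda>k. \<integral>x. f k x \<partial>\<mu>) \<longlonglongrightarrow> 0"
  proof (rule tendsto_integral_0_of_dominating_sequence[where g = g and G = G])
    show "f k \<in> borel_measurable \<mu>" for k unfolding f_def by measurable
    show "integrable \<mu> (g k)" for k unfolding g_def using uv by (intro dom)
    show "integrable \<mu> G" unfolding G_def using uv by (intro dom)
    show "0 \<le> f k x" for k x by (simp add: f_def R_def)
    show "f k x \<le> g k x" for k x
      unfolding f_def g_def R_def using neq[of k] score_residual_bound[OF K1, of "u k" "v k" x]
      by (intro mult_left_mono) (auto simp: pos_divide_le_eq mult.commute)
    show "(\<lambda>k. \<integral>x. g k x \<partial>\<mu>) \<longlonglongrightarrow> (\<integral>x. G x \<partial>\<mu>)"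
      unfolding g_def G_def dom(2)[OF uv(4,5)] dom(2)[OF uv(3,3)]
      by (intro tendsto_intros second_moment_quotient_tendsto uv)
  next
    fix x assume x: "x \<in> space \<mu>"
    have cont_\<phi>: "isCont (\<phi> x) m" using deriv_\<phi>[OF x \<Theta>(3)] by (rule DERIV_isCont)
    have \<phi>_v: "(\<lambda>k. \<phi> x (v k)) \<longlonglongrightarrow> \<phi> x m" and \<phi>_u: "(\<lambda>k. \<phi> x (u k)) \<longlonglongrightarrow> \<phi> x m"
      using uv cont_\<phi> by (auto intro: isCont_tendsto_compose)
    have \<phi>1_v: "(\<lambda>k. \<phi>\<^sub>1 x (v k)) \<longlonglongrightarrow> \<phi>\<^sub>1 x m"
      using uv cont_\<phi>1[OF x \<Theta>(3)] by (auto intro: isCont_tendsto_compose)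
    have quot: "(\<lambda>k. score_quotient (u k) (v k) x) \<longlonglongrightarrow> \<phi>\<^sub>1 x m"
      using divided_difference_tendsto_deriv[OF open_\<Theta> \<Theta>(3) deriv_\<phi>[OF x] cont_\<phi>1[OF x \<Theta>(3)] uv(1,2) neq]
      by (simp add: score_quotient_def neq)
    show "(\<lambda>k. g k x) \<longlonglongrightarrow> G x"
      using \<phi>_v quot \<phi>1_v unfolding g_def G_def by (auto simp: score_quotient_def[of m] score_quotient_def[of "v _"] intro!: tendsto_intros)
    have "(\<lambda>k. (exp (\<phi> x (u k)) - exp (\<phi> x (v k))) / (u k - v k)) \<longlonglongrightarrow> exp (\<phi> x m) * \<phi>\<^sub>1 x m"
      by (rule divided_difference_tendsto_deriv[OF open_\<Theta> \<Theta>(3) _ _ uv(1,2) neq])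
        (auto intro!: derivative_eq_intros deriv_\<phi>[OF x] continuous_intros cont_\<phi> cont_\<phi>1[OF x \<Theta>(3)])
    then have "(\<lambda>k. exp (- \<phi> x (v k)) * ((exp (\<phi> x (u k)) - exp (\<phi> x (v k))) / (u k - v k)))
        \<longlonglongrightarrow> exp (- \<phi> x m) * (exp (\<phi> x m) * \<phi>\<^sub>1 x m)"
      by (intro tendsto_intros \<phi>_v)
    then have ratio: "(\<lambda>k. (exp (\<phi> x (u k) - \<phi> x (v k)) - 1) / (u k - v k)) \<longlonglongrightarrow> \<phi>\<^sub>1 x m"
      by (simp add: exp_minus exp_diff field_simps)
    have "(\<lambda>k. exp (\<phi> x (u k) - \<phi> x (v k))) \<longlonglongrightarrow> exp (\<phi> x m - \<phi> x m)"
      by (intro tendsto_intros \<phi>_u \<phi>_v)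
    then have "\<forall>\<^sub>F k in sequentially. exp (\<phi> x (u k) - \<phi> x (v k)) < K"
      using K by (intro order_tendstoD) auto
    then have R_eq: "\<forall>\<^sub>F k in sequentially.
        ((exp (\<phi> x (u k) - \<phi> x (v k)) - 1) / (u k - v k) - \<phi>\<^sub>1 x (v k))\<^sup>2 = R k x"
    proof eventually_elim
      case (elim k)
      then show ?case
        using neq[of k] unfolding R_def trunc_ratio_def power_divide[symmetric]
        by (simp add: diff_divide_distrib)
    qed
    have "(\<lambda>k. ((exp (\<phi> x (u k) - \<phi> x (v k)) - 1) / (u k - v k) - \<phi>\<^sub>1 x (v k))\<^sup>2) \<longlonglongrightarrow> (\<phi>\<^sub>1 x m - \<phi>\<^sub>1 x m)\<^sup>2"
      by (intro tendsto_intros ratio \<phi>1_v)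
    then have "(\<lambda>k. R k x) \<longlonglongrightarrow> (\<phi>\<^sub>1 x m - \<phi>\<^sub>1 x m)\<^sup>2"
      by (rule Lim_transform_eventually[OF _ R_eq])
    then have "(\<lambda>k. f k x) \<longlonglongrightarrow> exp (\<phi> x m) * (\<phi>\<^sub>1 x m - \<phi>\<^sub>1 x m)\<^sup>2"
      unfolding f_def by (intro tendsto_intros \<phi>_v)
    then show "(\<lambda>k. f k x) \<longlonglongrightarrow> 0" by simp
  qed
  moreover have "(\<integral>x. f k x \<partial>\<mu>) =
      (\<integral>x. (trunc_ratio K (u k) (v k) x - 1 - (u k - v k) * \<phi>\<^sub>1 x (v k))\<^sup>2 \<partial>obs_law \<mu> \<phi> (v k)) / (u k - v k)\<^sup>2" for k
  proof -
    have "(\<integral>x. f k x \<partial>\<mu>) = (\<integral>x. R k x \<partial>obs_law \<mu> \<phi> (v k))"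
      unfolding f_def using \<Theta> by (intro integral_obs_law(1)[symmetric]) auto
    then show ?thesis by (simp add: R_def)
  qed
  ultimately show ?thesis by simp
qed

text \<open>
  Quadratic mean differentiability of the truncated likelihood ratio, uniformly on the compact
  parameter set: a failure along some sequence would contradict the previous lemma on a convergent
  subsequence.
\<close>

lemma uniform_score_approximation:
  assumes K: "K > 1" and \<epsilon>: "\<epsilon> > 0"
  obtains \<eta> where "\<eta> > 0"
    "\<And>m m'. m \<in> \<Theta>\<^sub>0 \<Longrightarrow> m' \<in> \<Theta>\<^sub>0 \<Longrightarrow> \<bar>m - m'\<bar> < \<eta> \<Longrightarrow>
      (\<integral>x. (trunc_ratio K m m' x - 1 - (m - m') * \<phi>\<^sub>1 x m')\<^sup>2 \<partial>obs_law \<mu> \<phi> m') \<le> \<epsilon> * (m - m')\<^sup>2"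
proof -
  define E where "E m m' = (\<integral>x. (trunc_ratio K m m' x - 1 - (m - m') * \<phi>\<^sub>1 x m')\<^sup>2 \<partial>obs_law \<mu> \<phi> m')" for m m'
  have "\<exists>\<eta>>0. \<forall>m\<in>\<Theta>\<^sub>0. \<forall>m'\<in>\<Theta>\<^sub>0. \<bar>m - m'\<bar> < \<eta> \<longrightarrow> E m m' \<le> \<epsilon> * (m - m')\<^sup>2"
  proof (rule ccontr)
    assume neg: "\<not> ?thesis"
    have "\<exists>m m'. m \<in> \<Theta>\<^sub>0 \<and> m' \<in> \<Theta>\<^sub>0 \<and> \<bar>m - m'\<bar> < inverse (real (Suc k)) \<and> \<epsilon> * (m - m')\<^sup>2 < E m m'" for k
    proof -
      have "inverse (real (Suc k)) > 0" by simp
      then have "\<not> (\<forall>m\<in>\<Theta>\<^sub>0. \<forall>m'\<in>\<Theta>\<^sub>0. \<bar>m - m'\<bar> < inverse (real (Suc k)) \<longrightarrow> E m m' \<le> \<epsilon> * (m - m')\<^sup>2)"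
        using neg by blast
      then show ?thesis unfolding Ball_def not_all not_imp not_le by blast
    qed
    then obtain u v where uv: "\<And>k. u k \<in> \<Theta>\<^sub>0" "\<And>k. v k \<in> \<Theta>\<^sub>0"
      "\<And>k. \<bar>u k - v k\<bar> < inverse (real (Suc k))" "\<And>k. \<epsilon> * (u k - v k)\<^sup>2 < E (u k) (v k)"
      by metis
    have neq: "u k \<noteq> v k" for k
    proof
      assume "u k = v k"
      with uv(4)[of k] K show False by (simp add: E_def trunc_ratio_def)
    qed
    obtain m s where m: "m \<in> \<Theta>\<^sub>0" and s: "strict_mono s" and vs: "(v \<circ> s) \<longlonglongrightarrow> m"
      using compact_\<Theta>0 uv(2) unfolding compact_def by metis
    have "(\<lambda>k. u k - v k) \<longlonglongrightarrow> 0"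
      by (rule Lim_null_comparison[OF _ LIMSEQ_inverse_real_of_nat])
        (use uv(3) in \<open>auto intro!: always_eventually less_imp_le\<close>)
    then have "((\<lambda>k. u k - v k) \<circ> s) \<longlonglongrightarrow> 0" by (rule LIMSEQ_subseq_LIMSEQ[OF _ s])
    from tendsto_add[OF this vs] have us: "(u \<circ> s) \<longlonglongrightarrow> m" by (simp add: comp_def)
    have "(\<lambda>k. E (u (s k)) (v (s k)) / (u (s k) - v (s k))\<^sup>2) \<longlonglongrightarrow> 0"
      unfolding E_def
      using score_residual_tendsto_0[OF K us vs m] uv neq by simp
    moreover have "\<epsilon> \<le> E (u (s k)) (v (s k)) / (u (s k) - v (s k))\<^sup>2" for k
      using uv(4)[of "s k"] neq[of "s k"] by (simp add: pos_le_divide_eq)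
    ultimately have "\<epsilon> \<le> 0" by (intro LIMSEQ_le_const) auto
    with \<epsilon> show False by simp
  qed
  then show ?thesis using that unfolding E_def by blast
qed

section \<open>Asymptotic indistinguishability under invariant tests\<close>

text \<open>
  The bound for fixed \<open>n\<close>, with every constant explicit. The three parts of the right-hand side
  come from the truncation, from the mean and from the second moment of \<open>S\<^sub>\<pi>\<close>.
\<close>

lemma invariant_test_discrepancy_bound:
  fixes m :: "nat \<Rightarrow> real" and n :: nat
  defines "b \<equiv> vec_mean n m"
  assumes T: "T \<in> invariant_tests \<mu> n"
    and m: "\<And>i. i < n \<Longrightarrow> m i \<in> \<Theta>\<^sub>0" "b \<in> \<Theta>\<^sub>0"
    and size: "L2_set (\<lambda>i. m i - b) {..<n} \<le> \<delta>" and n: "n \<ge> 2"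
    and K: "K > 1" and C: "C \<ge> 0"
      "\<And>m m'. m \<in> \<Theta>\<^sub>0 \<Longrightarrow> m' \<in> \<Theta>\<^sub>0 \<Longrightarrow> (\<integral>x. (score_quotient m m' x)\<^sup>2 \<partial>obs_law \<mu> \<phi> m') \<le> C"
    and \<eta>: "\<eta> > 0" "\<epsilon> \<ge> 0"
      "\<And>m m'. m \<in> \<Theta>\<^sub>0 \<Longrightarrow> m' \<in> \<Theta>\<^sub>0 \<Longrightarrow> \<bar>m - m'\<bar> < \<eta> \<Longrightarrow>
        (\<integral>x. (trunc_ratio K m m' x - 1 - (m - m') * \<phi>\<^sub>1 x m')\<^sup>2 \<partial>obs_law \<mu> \<phi> m') \<le> \<epsilon> * (m - m')\<^sup>2"
  defines "B \<equiv> K\<^sup>2 * C * \<delta>\<^sup>2"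
  defines "D \<equiv> 2 * \<epsilon> * \<delta>\<^sup>2 + 2 * (2 * K\<^sup>2 * C + 2 * C) * \<delta> ^ 4 / (\<eta>\<^sup>2 * n)"
  shows "((\<integral>x. T x \<partial>data_law \<mu> \<phi> n m) - (\<integral>x. T x \<partial>data_law \<mu> \<phi> n (\<lambda>_. b)))\<^sup>2
    \<le> 2 * (C / (ln K)\<^sup>2 * \<delta>\<^sup>2) + D + exp B * (2 * B\<^sup>2 / n + 2 * D\<^sup>2)"
proof -
  define P where "P = obs_law \<mu> \<phi> b"
  define r where "r i x = exp (\<phi> x (m i) - \<phi> x b)" for i x
  define g where "g i = trunc_ratio K (m i) b" for i
  define d where "d = (\<integral>x. (\<Sum>i<n. g i x - 1)\<^sup>2 \<partial>P) / n"
  have P: "prob_space P" unfolding P_def using m(2) by (intro prob_space_obs_law in_\<Theta>)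
  have obs: "obs_law \<mu> \<phi> (m i) = density P (r i)" if "i < n" for i
    unfolding P_def r_def using m that by (intro obs_law_eq_density in_\<Theta>) auto
  have law_m: "data_law \<mu> \<phi> n m = PiM {..<n} (\<lambda>i. density P (r i))"
    unfolding data_law_def by (intro PiM_cong) (simp_all add: obs)
  have law_b: "data_law \<mu> \<phi> n (\<lambda>_. b) = PiM {..<n} (\<lambda>_. P)"
    by (simp add: data_law_def P_def)
  have sets_P: "sets (PiM {..<n} (\<lambda>_. P)) = sets (PiM {..<n} (\<lambda>_. \<mu>))"
    by (intro sets_PiM_cong) (simp_all add: P_def)
  note space_P = sets_eq_imp_space_eq[OF sets_P]
  have size2: "(\<Sum>i<n. (m i - b)\<^sup>2) \<le> \<delta>\<^sup>2"
  proof -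
    have "(\<Sum>i<n. (m i - b)\<^sup>2) = (L2_set (\<lambda>i. m i - b) {..<n})\<^sup>2"
      by (simp add: L2_set_def sum_nonneg)
    also have "\<dots> \<le> \<delta>\<^sup>2" using size by (intro power_mono) simp_all
    finally show ?thesis .
  qed
  have centred: "(\<Sum>i<n. m i - b) = 0"
    using n by (simp add: sum_subtractf b_def vec_mean_def)
  \<comment> \<open>Turns a bound of order \<open>\<theta>\<^sub>i\<^sup>2\<close> on each coordinate into a bound on the sum.\<close>
  have weighted: "(\<Sum>i<n. a * (m i - b)\<^sup>2) \<le> a * \<delta>\<^sup>2" if "a \<ge> 0" for a
    using mult_left_mono[OF size2 that] by (simp add: sum_distrib_left)
  have meas_r: "r i \<in> borel_measurable P" and meas_g: "g i \<in> borel_measurable P" if "i \<in> {..<n}" for i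
  proof -
    have "m i \<in> \<Theta>" "b \<in> \<Theta>" using m that in_\<Theta> by auto
    then show "g i \<in> borel_measurable P" by (simp add: g_def P_def measurable_trunc_ratio)
    have [measurable]: "(\<lambda>x. \<phi> x (m i)) \<in> borel_measurable \<mu>" "(\<lambda>x. \<phi> x b) \<in> borel_measurable \<mu>"
      using \<open>m i \<in> \<Theta>\<close> \<open>b \<in> \<Theta>\<close> measurable_\<phi> by auto
    show "r i \<in> borel_measurable P" unfolding r_def P_def by simp
  qed
  have g_bounds: "0 \<le> g i x" "g i x \<le> r i x" "g i x \<le> K" for i x
    using K by (auto simp: g_def r_def trunc_ratio_def)
  have L1: "\<bar>(\<integral>x. T x \<partial>data_law \<mu> \<phi> n m) - (\<integral>x. T x \<partial>data_law \<mu> \<phi> n (\<lambda>_. b))\<bar>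
      \<le> (\<integral>x. \<bar>perm_avg_prod {..<n} g x - 1\<bar> \<partial>PiM {..<n} (\<lambda>_. P))"
    unfolding law_m law_b
  proof (rule invariant_test_discrepancy_le[OF P _ meas_r meas_g g_bounds(1,2)])
    show "prob_space (density P (r i))" if "i \<in> {..<n}" for i
      using that m(1)[of i] prob_space_obs_law in_\<Theta> by (simp flip: obs)
    show "T \<in> borel_measurable (PiM {..<n} (\<lambda>_. P))"
      using T by (simp add: invariant_tests_def measurable_cong_sets[OF sets_P refl])
  qed (use T in \<open>auto simp: invariant_tests_def space_P\<close>)
  have L1_le: "(\<integral>x. \<bar>perm_avg_prod {..<n} g x - 1\<bar> \<partial>PiM {..<n} (\<lambda>_. P))\<^sup>2
      \<le> 2 * (C / (ln K)\<^sup>2 * \<delta>\<^sup>2) + d + exp B * (2 * B\<^sup>2 / n + 2 * d\<^sup>2)"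
  proof -
    have 1: "(\<integral>x. g i x \<partial>P) \<le> 1" if "i \<in> {..<n}" for i
      unfolding g_def P_def using m that by (intro trunc_ratio_mean(1)[OF K _ _ C(2)]) auto
    have 2: "(\<Sum>i<n. \<integral>x. (g i x - 1)\<^sup>2 \<partial>P) \<le> B"
    proof -
      have "(\<Sum>i<n. \<integral>x. (g i x - 1)\<^sup>2 \<partial>P) \<le> (\<Sum>i<n. K\<^sup>2 * C * (m i - b)\<^sup>2)"
        unfolding g_def P_def using m K by (intro sum_mono trunc_ratio_moments(1)[OF _ _ _ C(2)]) auto
      also have "\<dots> \<le> B" unfolding B_def by (rule weighted) (use C in simp)
      finally show ?thesis .
    qed
    have 3: "(\<Sum>i<n. 1 - (\<integral>x. g i x \<partial>P)) \<le> C / (ln K)\<^sup>2 * \<delta>\<^sup>2"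
    proof -
      have "(\<Sum>i<n. 1 - (\<integral>x. g i x \<partial>P)) \<le> (\<Sum>i<n. C / (ln K)\<^sup>2 * (m i - b)\<^sup>2)"
        unfolding g_def P_def using m by (intro sum_mono trunc_ratio_mean(2)[OF K _ _ C(2)]) auto
      also have "\<dots> \<le> C / (ln K)\<^sup>2 * \<delta>\<^sup>2" by (rule weighted) (use C in simp)
      finally show ?thesis .
    qed
    show ?thesis
      using perm_avg_prod_L1_le[OF P _ _ meas_g g_bounds(1,3) 1 2 3] n by (simp add: d_def)
  qed
  have d: "d \<le> D"
  proof -
    have "(\<integral>x. (\<Sum>i\<in>{..<n}. g i x - 1)\<^sup>2 \<partial>P) / card {..<n}
        \<le> 2 * \<epsilon> * \<delta>\<^sup>2 + 2 * (2 * K\<^sup>2 * C + 2 * C) * \<delta> ^ 4 / (\<eta>\<^sup>2 * card {..<n})"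
    proof (rule integral_sum_square_le_of_score_approx[where \<theta> = "\<lambda>i. m i - b" and \<psi> = "\<lambda>x. \<phi>\<^sub>1 x b"])
      fix i assume i: "i \<in> {..<n}"
      show "integrable P (\<lambda>x. (g i x - 1 - (m i - b) * \<phi>\<^sub>1 x b)\<^sup>2)"
        unfolding g_def P_def using i m K by (intro integrable_trunc_ratio_square(2)) auto
      show "(\<lambda>x. g i x - 1) \<in> borel_measurable P" using meas_g[OF i] by simp
      show "(\<integral>x. (g i x - 1 - (m i - b) * \<phi>\<^sub>1 x b)\<^sup>2 \<partial>P) \<le> (2 * K\<^sup>2 * C + 2 * C) * (m i - b)\<^sup>2"
        unfolding g_def P_def using i m K by (intro trunc_ratio_moments(2)[OF _ _ _ C(2)]) auto
      show "(\<integral>x. (g i x - 1 - (m i - b) * \<phi>\<^sub>1 x b)\<^sup>2 \<partial>P) \<le> \<epsilon> * (m i - b)\<^sup>2" if "\<bar>m i - b\<bar> < \<eta>"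
        unfolding g_def P_def using i m that by (intro \<eta>(3)) auto
    next
      have "0 \<in> {..<n}" using n by simp
      then show "{..<n} \<noteq> {}" by blast
    qed (use size2 centred \<eta>(1,2) C(1) in auto)
    then show ?thesis by (simp add: d_def D_def)
  qed
  have d0: "d \<ge> 0" by (simp add: d_def)
  have "((\<integral>x. T x \<partial>data_law \<mu> \<phi> n m) - (\<integral>x. T x \<partial>data_law \<mu> \<phi> n (\<lambda>_. b)))\<^sup>2
      \<le> (\<integral>x. \<bar>perm_avg_prod {..<n} g x - 1\<bar> \<partial>PiM {..<n} (\<lambda>_. P))\<^sup>2"
    using power_mono[OF L1, of 2] by simp
  also note L1_le
  also have "2 * (C / (ln K)\<^sup>2 * \<delta>\<^sup>2) + d + exp B * (2 * B\<^sup>2 / n + 2 * d\<^sup>2)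
      \<le> 2 * (C / (ln K)\<^sup>2 * \<delta>\<^sup>2) + D + exp B * (2 * B\<^sup>2 / n + 2 * D\<^sup>2)"
  proof -
    have "d\<^sup>2 \<le> D\<^sup>2" using d d0 by (rule power_mono)
    then have "exp B * (2 * B\<^sup>2 / n + 2 * d\<^sup>2) \<le> exp B * (2 * B\<^sup>2 / n + 2 * D\<^sup>2)"
      by (intro mult_left_mono) auto
    with d show ?thesis by linarith
  qed
  finally show ?thesis .
qed

text \<open>
  The constants are chosen in the order \<open>K\<close>, \<open>\<epsilon>\<close>, \<open>\<eta>\<close>, \<open>n\<close>: the truncation level makes the loss of mass
  small, \<open>\<epsilon>\<close> is small relative to the resulting constant \<open>exp B\<close>, and \<open>\<eta>\<close> depends on both.
\<close>

lemma max_discrepancy_eventually_le: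
  assumes \<delta>: "\<delta> > 0" and e: "e > 0"
  shows "\<forall>\<^sub>F n in sequentially. max_discrepancy \<mu> \<phi> \<Theta>\<^sub>0 \<delta> n \<le> ennreal e"
proof -
  obtain C where C: "C \<ge> 0"
    "\<And>m m'. m \<in> \<Theta>\<^sub>0 \<Longrightarrow> m' \<in> \<Theta>\<^sub>0 \<Longrightarrow> (\<integral>x. (score_quotient m m' x)\<^sup>2 \<partial>obs_law \<mu> \<phi> m') \<le> C"
    by (rule second_moment_quotient_bounded) blast
  define L where "L = 1 + 6 * C * \<delta>\<^sup>2 / e\<^sup>2"
  define K where "K = exp L"
  define B where "B = K\<^sup>2 * C * \<delta>\<^sup>2"
  define X where "X = 1 + 2 * exp B"
  define y where "y = min 1 (e\<^sup>2 / (3 * X))"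
  define \<epsilon> where "\<epsilon> = y / (2 * \<delta>\<^sup>2)"
  have L: "L \<ge> 1" using C e by (simp add: L_def)
  have K: "K > 1" "ln K = L" using L by (auto simp: K_def)
  have loss: "2 * (C / (ln K)\<^sup>2 * \<delta>\<^sup>2) \<le> e\<^sup>2 / 3"
  proof -
    have "L \<le> L\<^sup>2" using L by (simp add: power2_eq_square)
    have "6 * C * \<delta>\<^sup>2 \<le> e\<^sup>2 * L" using e by (simp add: L_def field_simps)
    also have "\<dots> \<le> e\<^sup>2 * L\<^sup>2" using \<open>L \<le> L\<^sup>2\<close> by (intro mult_left_mono) auto
    finally show ?thesis using L unfolding K by (simp add: field_simps)
  qed
  have X: "X > 0" by (simp add: X_def add_pos_pos)
  have y: "y > 0" "y \<le> 1" using e X by (auto simp: y_def)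
  have "y + exp B * (2 * y\<^sup>2) \<le> y + exp B * (2 * y)"
    using y by (intro add_left_mono mult_left_mono) (auto simp: power2_eq_square)
  also have "\<dots> = y * X" by (simp add: X_def algebra_simps)
  also have "\<dots> \<le> e\<^sup>2 / (3 * X) * X"
    using X by (intro mult_right_mono) (auto simp: y_def)
  also have "\<dots> = e\<^sup>2 / 3" using X by simp
  finally have y_le: "y + exp B * (2 * y\<^sup>2) \<le> e\<^sup>2 / 3" .
  have \<epsilon>: "\<epsilon> > 0" "2 * \<epsilon> * \<delta>\<^sup>2 = y" using y \<delta> by (auto simp: \<epsilon>_def)
  obtain \<eta> where \<eta>: "\<eta> > 0"
    "\<And>m m'. m \<in> \<Theta>\<^sub>0 \<Longrightarrow> m' \<in> \<Theta>\<^sub>0 \<Longrightarrow> \<bar>m - m'\<bar> < \<eta> \<Longrightarrow>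
      (\<integral>x. (trunc_ratio K m m' x - 1 - (m - m') * \<phi>\<^sub>1 x m')\<^sup>2 \<partial>obs_law \<mu> \<phi> m') \<le> \<epsilon> * (m - m')\<^sup>2"
    by (rule uniform_score_approximation[OF K(1) \<epsilon>(1)]) blast
  define D where "D n = 2 * \<epsilon> * \<delta>\<^sup>2 + 2 * (2 * K\<^sup>2 * C + 2 * C) * \<delta> ^ 4 / (\<eta>\<^sup>2 * real n)" for n
  define \<beta> where "\<beta> n = 2 * (C / (ln K)\<^sup>2 * \<delta>\<^sup>2) + D n + exp B * (2 * B\<^sup>2 / real n + 2 * (D n)\<^sup>2)" for n
  have D_lim: "D \<longlonglongrightarrow> y + 0"
    unfolding D_def \<epsilon>(2) divide_divide_eq_left[symmetric]
    by (intro tendsto_intros lim_const_over_n)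
  have "\<beta> \<longlonglongrightarrow> 2 * (C / (ln K)\<^sup>2 * \<delta>\<^sup>2) + (y + 0) + exp B * (0 + 2 * (y + 0)\<^sup>2)"
    unfolding \<beta>_def by (intro tendsto_intros D_lim lim_const_over_n)
  moreover have "2 * (C / (ln K)\<^sup>2 * \<delta>\<^sup>2) + (y + 0) + exp B * (0 + 2 * (y + 0)\<^sup>2) < e\<^sup>2"
  proof -
    have "2 * (C / (ln K)\<^sup>2 * \<delta>\<^sup>2) + (y + exp B * (2 * y\<^sup>2)) \<le> e\<^sup>2 / 3 + e\<^sup>2 / 3"
      by (intro add_mono loss y_le)
    also have "\<dots> < e\<^sup>2" using e by simp
    finally show ?thesis by simp
  qed
  ultimately have "\<forall>\<^sub>F n in sequentially. \<beta> n < e\<^sup>2" by (rule order_tendstoD)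
  then show ?thesis
    using eventually_ge_at_top[of 2]
  proof eventually_elim
    case (elim n)
    show ?case
      unfolding max_discrepancy_def
    proof (rule Sup_least, clarify)
      fix T m assume T: "T \<in> invariant_tests \<mu> n"
        and m: "L2_set (\<lambda>i. m i - vec_mean n m) {..<n} \<le> \<delta>" "\<forall>i<n. m i \<in> \<Theta>\<^sub>0" "vec_mean n m \<in> \<Theta>\<^sub>0"
      have "((\<integral>x. T x \<partial>data_law \<mu> \<phi> n m) - (\<integral>x. T x \<partial>data_law \<mu> \<phi> n (\<lambda>_. vec_mean n m)))\<^sup>2 \<le> \<beta> n"
        unfolding \<beta>_def D_def B_def
        using m elim \<epsilon> by (intro invariant_test_discrepancy_bound T K(1) C \<eta>) auto
      also have "\<dots> \<le> e\<^sup>2" using elim by simp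
      finally show "ennreal \<bar>(\<integral>x. T x \<partial>data_law \<mu> \<phi> n m) - (\<integral>x. T x \<partial>data_law \<mu> \<phi> n (\<lambda>_. vec_mean n m))\<bar> \<le> ennreal e"
        using e by (intro ennreal_leI) (simp add: abs_le_square_iff[symmetric])
    qed
  qed
qed

end

theorem theorem5:
  fixes \<mu> :: "'a measure"
    and \<Theta> \<Theta>\<^sub>0 :: "real set"
    and \<phi> \<phi>\<^sub>1 \<phi>\<^sub>2 :: "'a \<Rightarrow> real \<Rightarrow> real"
    and \<iota> :: "real \<Rightarrow> real"
    and \<delta> :: real
  assumes "open \<Theta>"
    and "\<And>m. m \<in> \<Theta> \<Longrightarrow> (\<lambda>x. \<phi> x m) \<in> borel_measurable \<mu>"
    and "\<And>m. m \<in> \<Theta> \<Longrightarrow> prob_space (obs_law \<mu> \<phi> m)"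
    and "\<And>x m. x \<in> space \<mu> \<Longrightarrow> m \<in> \<Theta> \<Longrightarrow> (\<phi> x has_real_derivative \<phi>\<^sub>1 x m) (at m)"
    and "\<And>x m. x \<in> space \<mu> \<Longrightarrow> m \<in> \<Theta> \<Longrightarrow> (\<phi>\<^sub>1 x has_real_derivative \<phi>\<^sub>2 x m) (at m)"
    and "\<And>m. m \<in> \<Theta> \<Longrightarrow>
           integrable (obs_law \<mu> \<phi> m) (\<lambda>x. \<phi>\<^sub>1 x m) \<and>
           prob_space.expectation (obs_law \<mu> \<phi> m) (\<lambda>x. \<phi>\<^sub>1 x m) = 0"
    and "\<And>m. m \<in> \<Theta> \<Longrightarrow>
           integrable (obs_law \<mu> \<phi> m) (\<lambda>x. (\<phi>\<^sub>1 x m)\<^sup>2) \<and>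
           prob_space.variance (obs_law \<mu> \<phi> m) (\<lambda>x. \<phi>\<^sub>1 x m) = \<iota> m"
    and "\<And>m. m \<in> \<Theta> \<Longrightarrow>
           integrable (obs_law \<mu> \<phi> m) (\<lambda>x. \<phi>\<^sub>2 x m) \<and>
           prob_space.expectation (obs_law \<mu> \<phi> m) (\<lambda>x. \<phi>\<^sub>2 x m) = - \<iota> m"
    and "compact \<Theta>\<^sub>0" and "\<Theta>\<^sub>0 \<subseteq> \<Theta>"
    and "\<delta> > 0"
    and a: "\<exists>\<alpha>. \<forall>m\<in>\<Theta>\<^sub>0. \<forall>m'\<in>\<Theta>\<^sub>0.
           integrable (obs_law \<mu> \<phi> m) (\<lambda>x. \<phi> x m' - \<phi> x m) \<and>
           integrable (obs_law \<mu> \<phi> m) (\<lambda>x. (\<phi> x m' - \<phi> x m)\<^sup>2) \<and>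
           \<bar>prob_space.expectation (obs_law \<mu> \<phi> m) (\<lambda>x. \<phi> x m' - \<phi> x m)\<bar> \<le> \<alpha> * (m' - m)\<^sup>2 \<and>
           prob_space.variance (obs_law \<mu> \<phi> m) (\<lambda>x. \<phi> x m' - \<phi> x m) \<le> \<alpha> * (m' - m)\<^sup>2"
    and b: "((\<lambda>t. SUP m\<in>\<Theta>\<^sub>0. \<integral>\<^sup>+ x. ennreal (\<bar>\<phi>\<^sub>2 x m + \<iota> m\<bar> *
               indicator {x. \<bar>\<phi>\<^sub>2 x m + \<iota> m\<bar> \<ge> t} x) \<partial>obs_law \<mu> \<phi> m) \<longlongrightarrow> 0) at_top"
    and c: "((\<lambda>\<epsilon>. SUP m\<in>\<Theta>\<^sub>0. \<integral>\<^sup>+ x. modulus \<phi>\<^sub>2 \<Theta>\<^sub>0 \<epsilon> m x \<partial>obs_law \<mu> \<phi> m) \<longlongrightarrow> 0) (at_right 0)"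
    and d: "continuous_map (top_of_set (\<Theta>\<^sub>0 \<times> \<Theta>\<^sub>0)) finite_variance_topology
           (\<lambda>(m, m'). quotient_law \<mu> \<phi> \<phi>\<^sub>1 m m')"
  shows "max_discrepancy \<mu> \<phi> \<Theta>\<^sub>0 \<delta> \<longlonglongrightarrow> 0"
proof -
  have meas_\<phi>1: "(\<lambda>x. \<phi>\<^sub>1 x m) \<in> borel_measurable \<mu>" if "m \<in> \<Theta>" for m
    using assms(6)[OF that] by (auto simp: obs_law_def dest!: borel_measurable_integrable)
  have cont_\<phi>1: "isCont (\<phi>\<^sub>1 x) m" if "x \<in> space \<mu>" "m \<in> \<Theta>" for x m
    using assms(5)[OF that] by (rule DERIV_isCont)
  interpret score_family \<mu> \<Theta> \<Theta>\<^sub>0 \<phi> \<phi>\<^sub>1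
    by (rule score_family.intro) (fact assms meas_\<phi>1 cont_\<phi>1)+
  show ?thesis
  proof (rule order_tendstoI)
    fix a :: ennreal assume a: "0 < a"
    obtain e where e: "e > 0" "ennreal e < a"
    proof (cases a)
      case (real r)
      with a show ?thesis by (intro that[of "r / 2"]) (auto simp: ennreal_less_iff)
    qed (use that[of 1] in simp)
    from max_discrepancy_eventually_le[OF \<open>\<delta> > 0\<close> e(1)]
    show "\<forall>\<^sub>F n in sequentially. max_discrepancy \<mu> \<phi> \<Theta>\<^sub>0 \<delta> n < a"
      by eventually_elim (use e(2) in simp)
  qed simp
qed

end
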